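(* Let $1\le r\le n$. For any convex bodies $K_1,\dots,K_r,D \subset \mathbb{R}^n$, $$V(K_1,K_2,\dots,K_r,D^{n-r})\,\operatorname{vol}(D)^{r-1} \leq n^{r-1}\prod_{i=1}^r V(K_i,D^{n-1}).$$
   Context: A convex body in $\mathbb{R}^n$ is a nonempty compact convex subset (possibly with empty interior), and $\operatorname{vol}$ is the $n$-dimensional volume. For convex bodies $L_1,\dots,L_s\subset\mathbb{R}^n$ and $t_1,\dots,t_s \ge 0$, with $+$ denoting Minkowski sum, $$\operatorname{vol}(t_1L_1+\dots+t_sL_s)=\sum_{i_1+\dots+i_s=n}\frac{n!}{i_1!\cdots i_s!}V(L_1^{i_1},\dots,L_s^{i_s})\,t_1^{i_1}\cdots t_s^{i_s},$$ and the coefficients $V(L_1^{i_1},\dots,L_s^{i_s})$ are the mixed volumes; $V(L_1^{i_1},\dots,L_s^{i_s})$ is the (symmetric) mixed volume of $n$ bodies in which $L_j$ is repeated $i_j$ times (an exponent $1$ is omitted). In particular $V(L^n)=\operatorname{vol}(L)$. *)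

theory Defs
  imports "HOL-Analysis.Analysis" "HOL-Library.Set_Algebras"
begin

definition convex_body :: "'a::euclidean_space set \<Rightarrow> bool" where
  "convex_body K \<longleftrightarrow> K \<noteq> {} \<and> compact K \<and> convex K"

abbreviation vol :: "(real ^ 'n) set \<Rightarrow> real" where
  "vol K \<equiv> measure lebesgue K"

text \<open>Sums of sets are the Minkowski sums of Set_Algebras.\<close>

definition minkowski_comb :: "'a::real_vector set list \<Rightarrow> (nat \<Rightarrow> real) \<Rightarrow> 'a set" where
  "minkowski_comb Ls t = (\<Sum>j<length Ls. (\<lambda>x. t j *\<^sub>R x) ` (Ls ! j))"

definition multi_indices :: "nat \<Rightarrow> nat \<Rightarrow> nat list set" where
  "multi_indices s n = {e. length e = s \<and> sum_list e = n}"

definition mixed_volume_coeffs :: "(real ^ 'n) set list \<Rightarrow> (nat list \<Rightarrow> real) \<Rightarrow> bool" where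
  "mixed_volume_coeffs Ls c \<longleftrightarrow>
     (\<forall>t. (\<forall>j<length Ls. 0 \<le> t j) \<longrightarrow>
        vol (minkowski_comb Ls t) =
          (\<Sum>e\<in>multi_indices (length Ls) CARD('n).
             fact CARD('n) / (\<Prod>j<length Ls. fact (e ! j)) * c e
               * (\<Prod>j<length Ls. t j ^ (e ! j))))"

text \<open>
  \<open>mixed_volume [L\<^sub>1, \<dots>, L\<^sub>s] [e\<^sub>1, \<dots>, e\<^sub>s]\<close> is the mixed volume in which the body
  \<open>L\<^sub>j\<close> is repeated \<open>e\<^sub>j\<close> times. It is meaningful only for convex bodies and exponents with
  \<open>e\<^sub>1 + \<dots> + e\<^sub>s = n\<close>: there the coefficients exist by Minkowski's theorem, and they are
  unique because a polynomial is determined by its values on the nonnegative orthant.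
\<close>

definition mixed_volume :: "(real ^ 'n) set list \<Rightarrow> nat list \<Rightarrow> real" where
  "mixed_volume Ls e = (THE v. \<exists>c. mixed_volume_coeffs Ls c \<and> v = c e)"

end

theory Submission
  imports Defs
begin

text \<open>
  For a finite set \<open>A\<close> of points with weights \<open>w\<close>, the gradient of the convex function
  \<open>ln (\<Sum>\<^sub>a w\<^sub>a exp (a \<bullet> x))\<close> is the mean of a Gibbs measure on \<open>A\<close>, and its Hessian is the covariance
  matrix. The gradient of a nonnegative combination of such functions maps onto the corresponding
  Minkowski combination of polytopes up to a null set, injectively unless that set is flat. So its
  volume is the integral of the determinant of a combination of covariance matrices. Expanding this determinant as a weighted Gram
  determinant gives the volume polynomial with nonnegative coefficients. The mixed volumes of
  polytopes depend only on the support of the weights, and letting weights tend to zero shows by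
  Fatou's lemma that they are monotone. Exhausting convex bodies by polytopes extends existence,
  nonnegativity and monotonicity to all convex bodies.

  If no translate of \<open>\<tau>K\<close> fits into \<open>D\<close>, then \<open>vol D \<le> \<tau> n V(K, D\<^bsup>n-1\<^esup>)\<close>. Hence a translate of \<open>\<mu>D\<close>
  contains \<open>K\<close> for each \<open>\<mu> > n V(K, D\<^bsup>n-1\<^esup>) / vol D\<close>, and monotonicity allows one to replace
  \<open>K\<^sub>1, \<dots>, K\<^sub>r\<^sub>-\<^sub>1\<close> one after the other by multiples of \<open>D\<close>.
\<close>

text \<open>The shape of the bound comes from the replacements. Each one pulls out a factor
  \<open>\<mu>\<close>, which can be taken down to \<open>n V(K_i, D^(n-1)) / vol D\<close>. After
  \<open>r - 1\<close> of them only \<open>V(K_r, D^(n-1))\<close> is left, and this is the factor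
  without an \<open>n\<close>. If \<open>vol D = 0\<close> and \<open>r > 1\<close>, the left side
  vanishes and nonnegativity of the right side suffices.

  The estimate \<open>vol D \<le> \<tau> n V(K, D^(n-1))\<close> is a statement about a derivative.
  If \<open>\<tau> K\<close> does not fit into \<open>D\<close>, then
  \<open>vol (D + h K) \<ge> (1 + 1/N) vol D\<close> for \<open>h = \<tau>/N\<close>, and letting
  \<open>N\<close> grow bounds the linear coefficient of this polynomial in \<open>h\<close> from
  below.

  Mixed volumes are given only as coefficients of a volume polynomial, so their sign and
  monotonicity cannot be read off. The integral of a determinant makes the expansion pointwise: at
  each \<open>x\<close> a coefficient is a sum of products of probabilities and squared
  determinants. The integrand depends on the weights while its integral sees only the polytopes.
  This freedom allows a larger polytope to be kept fixed while its Gibbs measures degenerate to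
  those of a smaller one.\<close>

section \<open>Determinants of weighted Gram matrices\<close>

lemma det_rows_sum:
  fixes a :: "'n::finite \<Rightarrow> 'k \<Rightarrow> real ^ 'n"
  assumes "finite I"
  shows "det (\<chi> i. \<Sum>k\<in>I. a i k) = (\<Sum>f | \<forall>i. f i \<in> I. det (\<chi> i. a i (f i)))"
proof -
  have F: "PiE UNIV (\<lambda>_::'n. I) = {f. \<forall>i. f i \<in> I}"
    by (auto simp: PiE_def extensional_def)
  have "det (\<chi> i. \<Sum>k\<in>I. a i k) = (\<Sum>p | p permutes (UNIV :: 'n set).
      of_int (sign p) * (\<Sum>f | \<forall>i. f i \<in> I. \<Prod>i\<in>UNIV. a i (f i) $ p i))"
    unfolding det_def by (simp add: prod_sum_PiE assms F)
  also have "\<dots> = (\<Sum>f | \<forall>i. f i \<in> I. \<Sum>p | p permutes (UNIV :: 'n set).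
      of_int (sign p) * (\<Prod>i\<in>UNIV. a i (f i) $ p i))"
    unfolding sum_distrib_left by (rule sum.swap)
  finally show ?thesis by (simp add: det_def)
qed

text \<open>A form of the Cauchy-Binet formula. The sum runs over all maps \<open>f\<close> instead
  of subsets of \<open>I\<close>: non-injective maps give a repeated row and contribute zero, and
  each subset is counted \<open>n!\<close> times, hence the division. Expanding by rows yields only
  one diagonal product per \<open>f\<close>; averaging over all reorderings of \<open>f\<close>
  completes it to a second determinant.\<close>

lemma det_weighted_gram:
  fixes b :: "'k \<Rightarrow> real ^ 'n" and c :: "'k \<Rightarrow> real"
  assumes "finite I"
  shows "det (\<chi> i j. \<Sum>k\<in>I. c k * b k $ i * b k $ j)
       = (\<Sum>f | \<forall>i. f i \<in> I. (\<Prod>i\<in>UNIV. c (f i)) * (det (\<chi> i. b (f i)))\<^sup>2) / fact CARD('n)"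
proof -
  define F where "F = {f :: 'n \<Rightarrow> 'k. \<forall>i. f i \<in> I}"
  define P where "P = {p :: 'n \<Rightarrow> 'n. p permutes UNIV}"
  define h where "h f = (\<Prod>i\<in>UNIV. c (f i)) * (\<Prod>i\<in>UNIV. b (f i) $ i) * det (\<chi> i. b (f i))" for f
  define d where "d = det (\<chi> i j. \<Sum>k\<in>I. c k * b k $ i * b k $ j)"
  have "(\<chi> i j. \<Sum>k\<in>I. c k * b k $ i * b k $ j) = (\<chi> i. \<Sum>k\<in>I. (c k * b k $ i) *s b k)"
    by (simp add: vec_eq_iff)
  then have d: "d = (\<Sum>f\<in>F. h f)"
    unfolding d_def F_def h_def
    by (simp only: det_rows_sum[OF assms] det_rows_mul prod.distrib)
  have perm: "(\<Sum>f\<in>F. h f) = (\<Sum>f\<in>F. h (f \<circ> p))" if "p \<in> P" for p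
  proof -
    have "bij p" using that unfolding P_def by (simp add: permutes_bij)
    then have *: "\<And>f. f \<circ> inv p \<circ> p = f" "\<And>f. f \<circ> p \<circ> inv p = f"
      by (simp_all add: comp_assoc bij_is_inj inv_o_cancel bij_is_surj surj_iff[THEN iffD1])
    show ?thesis
      by (rule sum.reindex_bij_witness[of _ "\<lambda>f. f \<circ> p" "\<lambda>f. f \<circ> inv p"]) (auto simp: F_def *)
  qed
  \<comment> \<open>Reordering the rows costs a sign, and this sign times the product of the entries
    \<open>b (f (p i)) $ i\<close> is the Leibniz term of \<open>p\<close> for the transposed
    matrix.\<close>
  have term1: "h (f \<circ> p) = (\<Prod>i\<in>UNIV. c (f i)) * det (\<chi> i. b (f i))
      * (of_int (sign p) * (\<Prod>i\<in>UNIV. (\<chi> i. b (f i)) $ p i $ i))" if "p \<in> P" for f p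
  proof -
    have p: "p permutes UNIV" using that by (simp add: P_def)
    have "(\<Prod>i\<in>UNIV. c (f (p i))) = (\<Prod>i\<in>UNIV. c (f i))"
      using prod.permute[OF p, of "\<lambda>i. c (f i)"] by (simp add: comp_def)
    moreover have "det (\<chi> i. b (f (p i))) = of_int (sign p) * det (\<chi> i. b (f i))"
      using det_permute_rows[OF p, of "\<chi> i. b (f i)"] by simp
    ultimately show ?thesis
      by (simp add: h_def)
  qed
  have detT: "(\<Sum>p\<in>P. of_int (sign p) * (\<Prod>i\<in>UNIV. A $ p i $ i)) = det A" for A :: "real^'n^'n"
  proof -
    have "det (transpose A) = (\<Sum>p\<in>P. of_int (sign p) * (\<Prod>i\<in>UNIV. A $ p i $ i))"
      unfolding det_def P_def transpose_def by simp
    then show ?thesis by (simp add: det_transpose)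
  qed
  have "real (card P) * d = (\<Sum>p\<in>P. \<Sum>f\<in>F. h (f \<circ> p))"
    by (simp add: d perm[symmetric] cong: sum.cong)
  also have "\<dots> = (\<Sum>f\<in>F. \<Sum>p\<in>P. h (f \<circ> p))"
    by (rule sum.swap)
  also have "\<dots> = (\<Sum>f\<in>F. (\<Prod>i\<in>UNIV. c (f i)) * (det (\<chi> i. b (f i)))\<^sup>2)"
    by (rule sum.cong[OF refl], simp only: term1 cong: sum.cong, subst sum_distrib_left[symmetric])
      (simp only: detT power2_eq_square mult.assoc)
  finally have "fact CARD('n) * d = (\<Sum>f\<in>F. (\<Prod>i\<in>UNIV. c (f i)) * (det (\<chi> i. b (f i)))\<^sup>2)"
    by (simp add: P_def card_permutations)
  then show ?thesis
    unfolding d_def[symmetric] F_def by (simp add: field_simps)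
qed


section \<open>Gibbs measures on finite point sets and their derivatives\<close>

definition partition_fun :: "('a::real_inner \<Rightarrow> real) \<Rightarrow> 'a set \<Rightarrow> 'a \<Rightarrow> real" where
  "partition_fun w A x = (\<Sum>a\<in>A. w a * exp (a \<bullet> x))"

definition gibbs :: "('a::real_inner \<Rightarrow> real) \<Rightarrow> 'a set \<Rightarrow> 'a \<Rightarrow> 'a \<Rightarrow> real" where
  "gibbs w A x a = w a * exp (a \<bullet> x) / partition_fun w A x"

definition gibbs_mean :: "('a::real_inner \<Rightarrow> real) \<Rightarrow> 'a set \<Rightarrow> 'a \<Rightarrow> 'a" where
  "gibbs_mean w A x = (\<Sum>a\<in>A. gibbs w A x a *\<^sub>R a)"

definition weight_on :: "('a \<Rightarrow> real) \<Rightarrow> 'a set \<Rightarrow> bool" where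
  "weight_on w A \<longleftrightarrow> finite A \<and> (\<forall>a\<in>A. 0 \<le> w a) \<and> (\<exists>a\<in>A. 0 < w a)"

lemma partition_fun_pos: "weight_on w A \<Longrightarrow> 0 < partition_fun w A x"
  unfolding partition_fun_def weight_on_def by (auto intro!: sum_pos2)

lemma gibbs_nonneg: "weight_on w A \<Longrightarrow> a \<in> A \<Longrightarrow> 0 \<le> gibbs w A x a"
  using partition_fun_pos[of w A x] by (auto simp: gibbs_def weight_on_def)

lemma gibbs_pos_iff: "weight_on w A \<Longrightarrow> a \<in> A \<Longrightarrow> 0 < gibbs w A x a \<longleftrightarrow> 0 < w a"
  using partition_fun_pos[of w A x] by (auto simp: gibbs_def zero_less_divide_iff zero_less_mult_iff)

lemma sum_gibbs: "weight_on w A \<Longrightarrow> (\<Sum>a\<in>A. gibbs w A x a) = 1"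
  using partition_fun_pos[of w A x]
  by (simp add: gibbs_def partition_fun_def sum_divide_distrib[symmetric])

lemma has_derivative_ln_partition_fun:
  fixes x :: "'a::real_inner"
  assumes "weight_on w A"
  shows "((\<lambda>x. ln (partition_fun w A x)) has_derivative (\<lambda>v. gibbs_mean w A x \<bullet> v)) (at x)"
proof -
  have Z: "0 < partition_fun w A x" using partition_fun_pos[OF assms] .
  have "((\<lambda>x. partition_fun w A x) has_derivative
      (\<lambda>v. \<Sum>a\<in>A. w a * (exp (a \<bullet> x) * (a \<bullet> v)))) (at x)"
    unfolding partition_fun_def by (auto intro!: derivative_eq_intros simp: algebra_simps)
  from has_derivative_ln[OF Z this]
  have "((\<lambda>x. ln (partition_fun w A x)) has_derivative
      (\<lambda>v. (\<Sum>a\<in>A. w a * (exp (a \<bullet> x) * (a \<bullet> v))) * inverse (partition_fun w A x))) (at x)" .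
  moreover have "(\<lambda>v. (\<Sum>a\<in>A. w a * (exp (a \<bullet> x) * (a \<bullet> v))) * inverse (partition_fun w A x))
      = (\<lambda>v. gibbs_mean w A x \<bullet> v)"
    by (simp add: fun_eq_iff gibbs_mean_def gibbs_def inner_sum_left sum_distrib_left divide_inverse ac_simps)
  ultimately show ?thesis by simp
qed

lemma has_derivative_gibbs:
  fixes x :: "'a::real_inner"
  assumes "weight_on w A"
  shows "((\<lambda>x. gibbs w A x a) has_derivative
      (\<lambda>v. gibbs w A x a * ((a - gibbs_mean w A x) \<bullet> v))) (at x)"
proof -
  have Z: "0 < partition_fun w A y" for y using partition_fun_pos[OF assms] .
  \<comment> \<open>In exponential form the logarithmic derivative is visibly \<open>a\<close> minus
    the gradient of the log-partition function, that is, minus the mean.\<close>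
  have eq: "gibbs w A y a = w a * exp (a \<bullet> y - ln (partition_fun w A y))" for y
    using Z[of y] by (simp add: gibbs_def exp_diff)
  show ?thesis unfolding eq
    by (rule derivative_eq_intros has_derivative_ln_partition_fun[OF assms] refl)+
       (simp add: fun_eq_iff inner_diff_left algebra_simps)
qed

lemma sum_gibbs_centered:
  assumes "weight_on w A"
  shows "(\<Sum>a\<in>A. gibbs w A x a *\<^sub>R (a - gibbs_mean w A x)) = 0"
  using sum_gibbs[OF assms, of x]
  by (simp add: scaleR_diff_right sum_subtractf gibbs_mean_def[symmetric] scaleR_left.sum[symmetric])

text \<open>Differentiating the probabilities leaves the uncentred \<open>a\<close> as last factor.
  It may be centred because the derivatives of the probabilities sum to zero. The centred form shows
  the derivative to be the covariance operator, hence a weighted Gram matrix.\<close>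

lemma has_derivative_gibbs_mean:
  fixes x :: "'a::real_inner"
  assumes "weight_on w A"
  shows "(gibbs_mean w A has_derivative
      (\<lambda>v. \<Sum>a\<in>A. (gibbs w A x a * ((a - gibbs_mean w A x) \<bullet> v)) *\<^sub>R (a - gibbs_mean w A x))) (at x)"
proof -
  have "(gibbs_mean w A has_derivative
      (\<lambda>v. \<Sum>a\<in>A. (gibbs w A x a * ((a - gibbs_mean w A x) \<bullet> v)) *\<^sub>R a)) (at x)"
    unfolding gibbs_mean_def[abs_def]
    by (rule has_derivative_sum has_derivative_scaleR_left has_derivative_gibbs[OF assms, unfolded gibbs_mean_def])+
  moreover have "(\<Sum>a\<in>A. (gibbs w A x a * ((a - gibbs_mean w A x) \<bullet> v)) *\<^sub>R a)
     = (\<Sum>a\<in>A. (gibbs w A x a * ((a - gibbs_mean w A x) \<bullet> v)) *\<^sub>R (a - gibbs_mean w A x))" for v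
  proof -
    have "(\<Sum>a\<in>A. gibbs w A x a * ((a - gibbs_mean w A x) \<bullet> v)) = 0"
      using arg_cong[OF sum_gibbs_centered[OF assms, of x], of "\<lambda>u. u \<bullet> v"] by (simp add: inner_sum_left)
    then show ?thesis
      by (simp add: scaleR_diff_right sum_subtractf scaleR_left.sum[symmetric])
  qed
  ultimately show ?thesis by simp
qed

section \<open>Gradient images of log-partition functions\<close>

lemma minkowski_comb_eq:
  "minkowski_comb Ls t = {\<Sum>j<length Ls. t j *\<^sub>R y j | y. \<forall>j<length Ls. y j \<in> Ls ! j}"
proof -
  have "(\<exists>z. v = sum z {..<length Ls} \<and> (\<forall>i<length Ls. z i \<in> (*\<^sub>R) (t i) ` Ls ! i))
    \<longleftrightarrow> (\<exists>y. v = (\<Sum>j<length Ls. t j *\<^sub>R y j) \<and> (\<forall>j<length Ls. y j \<in> Ls ! j))" for v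
  proof (intro iffI; elim exE conjE)
    fix z assume v: "v = sum z {..<length Ls}" and z: "\<forall>i<length Ls. z i \<in> (*\<^sub>R) (t i) ` Ls ! i"
    then have "\<forall>i. \<exists>y. i < length Ls \<longrightarrow> y \<in> Ls ! i \<and> z i = t i *\<^sub>R y" by blast
    then obtain y where "\<forall>i<length Ls. y i \<in> Ls ! i \<and> z i = t i *\<^sub>R y i" by metis
    then show "\<exists>y. v = (\<Sum>j<length Ls. t j *\<^sub>R y j) \<and> (\<forall>j<length Ls. y j \<in> Ls ! j)"
      unfolding v by (intro exI[of _ y]) simp
  next
    fix y assume "v = (\<Sum>j<length Ls. t j *\<^sub>R y j)" "\<forall>j<length Ls. y j \<in> Ls ! j"
    then show "\<exists>z. v = sum z {..<length Ls} \<and> (\<forall>i<length Ls. z i \<in> (*\<^sub>R) (t i) ` Ls ! i)"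
      by (intro exI[of _ "\<lambda>j. t j *\<^sub>R y j"]) auto
  qed
  then show ?thesis
    unfolding minkowski_comb_def set_sum_alt[OF finite_lessThan] Ball_def lessThan_iff
    by (intro Collect_cong) simp
qed

lemma convex_minkowski_comb:
  assumes "\<And>L. L \<in> set Ls \<Longrightarrow> convex L"
  shows "convex (minkowski_comb Ls t)"
  unfolding minkowski_comb_def
  by (intro convex_set_sum convex_scaling) (use assms in auto)

lemma compact_set_plus:
  fixes S T :: "'a::real_normed_vector set"
  assumes "compact S" "compact T"
  shows "compact (S + T)"
proof -
  have "S + T = {a + b |a b. a \<in> S \<and> b \<in> T}" by (auto simp: set_plus_def)
  then show ?thesis using compact_sums[OF assms] by simp
qed

lemma compact_set_sum:
  fixes B :: "'b \<Rightarrow> 'a::real_normed_vector set"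
  assumes "\<And>i. i \<in> A \<Longrightarrow> compact (B i)"
  shows "compact (\<Sum>i\<in>A. B i)"
  using assms
proof (induction A rule: infinite_finite_induct)
  case (insert x F)
  then show ?case by (simp add: compact_set_plus)
qed (auto simp: set_zero)

lemma compact_minkowski_comb:
  fixes Ls :: "'a::real_normed_vector set list"
  assumes "\<And>L. L \<in> set Ls \<Longrightarrow> compact L"
  shows "compact (minkowski_comb Ls t)"
  unfolding minkowski_comb_def
  by (intro compact_set_sum compact_scaling) (use assms in auto)

lemma finite_multi_indices: "finite (multi_indices s n)"
proof (rule finite_subset)
  show "multi_indices s n \<subseteq> {xs. set xs \<subseteq> {..n} \<and> length xs = s}"
    by (auto simp: multi_indices_def member_le_sum_list)
qed (simp add: finite_lists_length_eq)

definition weight_support :: "('a \<Rightarrow> real) \<Rightarrow> 'a set \<Rightarrow> 'a set" where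
  "weight_support w A = {a\<in>A. 0 < w a}"

lemma gibbs_mean_in_hull:
  assumes "weight_on w A"
  shows "gibbs_mean w A x \<in> convex hull (weight_support w A)"
proof -
  have fin: "finite A" using assms by (simp add: weight_on_def)
  have z: "gibbs w A x a = 0" if "a \<in> A - weight_support w A" for a
    using that assms by (auto simp: weight_support_def weight_on_def gibbs_def)
  have 1: "gibbs_mean w A x = (\<Sum>a\<in>weight_support w A. gibbs w A x a *\<^sub>R a)"
    unfolding gibbs_mean_def
    by (rule sum.mono_neutral_right) (use fin z in \<open>auto simp: weight_support_def\<close>)
  have 2: "(\<Sum>a\<in>weight_support w A. gibbs w A x a) = (\<Sum>a\<in>A. gibbs w A x a)"
    by (rule sum.mono_neutral_left) (use fin z in \<open>auto simp: weight_support_def\<close>)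
  show ?thesis unfolding 1
    by (rule convex_sum)
      (use fin 2 sum_gibbs[OF assms] gibbs_nonneg[OF assms] in
        \<open>auto simp: weight_support_def hull_inc\<close>)
qed

text \<open>Keeping a single summand of the partition function bounds \<open>a \<bullet> x\<close>
  for each point \<open>a\<close> of positive weight, and such a bound passes to the convex hull.
  Since \<open>C\<close> is independent of \<open>x\<close>, the log-partition function grows like
  the support function of the polytope, which yields coercivity below.\<close>

lemma ln_partition_fun_ge:
  fixes A :: "'a::real_inner set"
  assumes "weight_on w A"
  obtains C where "\<And>x y. y \<in> convex hull (weight_support w A) \<Longrightarrow> y \<bullet> x \<le> ln (partition_fun w A x) + C"
proof
  define S where "S = weight_support w A"
  define C where "C = Max ((\<lambda>a. - ln (w a)) ` S)"
  have fin: "finite S" using assms by (simp add: weight_on_def S_def weight_support_def)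
  fix x y assume y: "y \<in> convex hull (weight_support w A)"
  have "a \<bullet> x \<le> ln (partition_fun w A x) + C" if "a \<in> S" for a
  proof -
    have wa: "a \<in> A" "0 < w a" using that by (auto simp: S_def weight_support_def)
    have "w a * exp (a \<bullet> x) \<le> partition_fun w A x"
      unfolding partition_fun_def
      by (rule member_le_sum[of a A "\<lambda>a. w a * exp (a \<bullet> x)"])
        (use assms wa in \<open>auto simp: weight_on_def\<close>)
    then have "ln (w a * exp (a \<bullet> x)) \<le> ln (partition_fun w A x)"
      using wa by (intro ln_mono) auto
    moreover have "ln (w a * exp (a \<bullet> x)) = ln (w a) + a \<bullet> x"
      using wa by (simp add: ln_mult)
    moreover have "- ln (w a) \<le> C"
      unfolding C_def using fin that by (intro Max_ge) auto
    ultimately show ?thesis by linarith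
  qed
  then have "S \<subseteq> {z. z \<bullet> x \<le> ln (partition_fun w A x) + C}" by auto
  moreover have "convex {z. z \<bullet> x \<le> ln (partition_fun w A x) + C}"
    using convex_halfspace_le[of x] by (simp add: inner_commute)
  ultimately have "convex hull S \<subseteq> {z. z \<bullet> x \<le> ln (partition_fun w A x) + C}"
    by (rule hull_minimal)
  then show "y \<bullet> x \<le> ln (partition_fun w A x) + C"
    using y by (auto simp: S_def)
qed

definition weighted_polytopes :: "nat \<Rightarrow> (nat \<Rightarrow> 'a::real_vector \<Rightarrow> real) \<Rightarrow> (nat \<Rightarrow> 'a set) \<Rightarrow> 'a set list" where
  "weighted_polytopes s w A = map (\<lambda>j. convex hull (weight_support (w j) (A j))) [0..<s]"

text \<open>The gradient of the sum of \<open>t j * ln (partition_fun (w j) (A j) x)\<close>; in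
  toric geometry the corresponding map onto a polytope is called the moment map.\<close>

definition moment_map :: "nat \<Rightarrow> (nat \<Rightarrow> 'a::real_inner \<Rightarrow> real) \<Rightarrow> (nat \<Rightarrow> 'a set) \<Rightarrow> (nat \<Rightarrow> real) \<Rightarrow> 'a \<Rightarrow> 'a" where
  "moment_map s w A t x = (\<Sum>j<s. t j *\<^sub>R gibbs_mean (w j) (A j) x)"

definition moment_deriv :: "nat \<Rightarrow> (nat \<Rightarrow> 'a::real_inner \<Rightarrow> real) \<Rightarrow> (nat \<Rightarrow> 'a set) \<Rightarrow> (nat \<Rightarrow> real) \<Rightarrow> 'a \<Rightarrow> 'a \<Rightarrow> 'a" where
  "moment_deriv s w A t x v = (\<Sum>j<s. t j *\<^sub>R (\<Sum>a\<in>A j. (gibbs (w j) (A j) x a *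
     ((a - gibbs_mean (w j) (A j) x) \<bullet> v)) *\<^sub>R (a - gibbs_mean (w j) (A j) x)))"

lemma weighted_polytopes_comb:
  "minkowski_comb (weighted_polytopes s w A) t
     = {\<Sum>j<s. t j *\<^sub>R y j | y. \<forall>j<s. y j \<in> convex hull (weight_support (w j) (A j))}"
  unfolding minkowski_comb_eq by (simp add: weighted_polytopes_def)

context
  fixes s :: nat and w :: "nat \<Rightarrow> 'a::euclidean_space \<Rightarrow> real" and A :: "nat \<Rightarrow> 'a set"
  assumes w: "\<And>j. j < s \<Longrightarrow> weight_on (w j) (A j)"
begin

lemma has_derivative_moment_map:
  "(moment_map s w A t has_derivative moment_deriv s w A t x) (at x)"
  unfolding moment_map_def[abs_def] moment_deriv_def[abs_def]
  by (intro has_derivative_sum has_derivative_scaleR_right has_derivative_gibbs_mean w) auto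

lemma moment_map_in_comb: "moment_map s w A t x \<in> minkowski_comb (weighted_polytopes s w A) t"
  unfolding weighted_polytopes_comb moment_map_def
  by (intro CollectI exI[of _ "\<lambda>j. gibbs_mean (w j) (A j) x"]) (simp add: gibbs_mean_in_hull w)

lemma convex_comb_polytopes: "convex (minkowski_comb (weighted_polytopes s w A) t)"
  by (intro convex_minkowski_comb) (auto simp: weighted_polytopes_def)

lemma compact_comb_polytopes: "compact (minkowski_comb (weighted_polytopes s w A) t)"
  using w by (intro compact_minkowski_comb)
    (auto simp: weighted_polytopes_def weight_on_def weight_support_def intro!: finite_imp_compact_convex_hull)

text \<open>A point \<open>p\<close> of the interior is attained where the coercive function
  \<open>\<Sum>\<^sub>j t\<^sub>j ln Z\<^sub>j(x) - p \<bullet> x\<close> is minimal.\<close>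

lemma interior_subset_range_moment_map:
  assumes t: "\<And>j. j < s \<Longrightarrow> 0 \<le> t j"
  shows "interior (minkowski_comb (weighted_polytopes s w A) t) \<subseteq> range (moment_map s w A t)"
proof
  let ?X = "minkowski_comb (weighted_polytopes s w A) t"
  fix p assume "p \<in> interior ?X"
  then obtain r where r: "r > 0" "cball p r \<subseteq> ?X" by (auto simp: mem_interior_cball)
  define \<Phi> where "\<Phi> x = (\<Sum>j<s. t j * ln (partition_fun (w j) (A j) x))" for x
  have "\<forall>j. \<exists>C. j < s \<longrightarrow> (\<forall>x y. y \<in> convex hull (weight_support (w j) (A j)) \<longrightarrow> y \<bullet> x \<le> ln (partition_fun (w j) (A j) x) + C)"
    using ln_partition_fun_ge[OF w] by metis
  then obtain C where C: "\<And>j x y. j < s \<Longrightarrow> y \<in> convex hull (weight_support (w j) (A j)) \<Longrightarrow>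
      y \<bullet> x \<le> ln (partition_fun (w j) (A j) x) + C j" by metis
  define B where "B = (\<Sum>j<s. t j * C j)"
  have lower: "y \<bullet> x \<le> \<Phi> x + B" if y: "y \<in> ?X" for x y
  proof -
    obtain u where u: "y = (\<Sum>j<s. t j *\<^sub>R u j)" "\<And>j. j < s \<Longrightarrow> u j \<in> convex hull (weight_support (w j) (A j))"
      using y unfolding weighted_polytopes_comb by blast
    have "y \<bullet> x = (\<Sum>j<s. t j * (u j \<bullet> x))" by (simp add: u inner_sum_left)
    also have "\<dots> \<le> (\<Sum>j<s. t j * (ln (partition_fun (w j) (A j) x) + C j))"
      by (intro sum_mono mult_left_mono C u t) auto
    finally show ?thesis by (simp add: \<Phi>_def B_def distrib_left sum.distrib)
  qed
  define f where "f x = \<Phi> x - p \<bullet> x" for x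
  have coerc: "r * norm x - B \<le> f x" for x
  proof (cases "x = 0")
    case True
    have "p \<in> ?X" using r by auto
    from lower[OF this, of x] True r show ?thesis by (simp add: f_def)
  next
    case False
    \<comment> \<open>The point of the ball around \<open>p\<close> farthest in the direction of
      \<open>x\<close>: its inner product with \<open>x\<close> exceeds that of \<open>p\<close> by
      \<open>r * norm x\<close>.\<close>
    have "p + (r / norm x) *\<^sub>R x \<in> ?X" using r False by (intro subsetD[OF r(2)]) (auto simp: dist_norm)
    from lower[OF this, of x] False r show ?thesis
      by (simp add: f_def inner_add_left dot_square_norm power2_eq_square)
  qed
  have df: "(f has_derivative (\<lambda>v. moment_map s w A t x \<bullet> v - p \<bullet> v)) (at x)" for x
  proof -
    have "((\<lambda>x. \<Sum>j<s. t j * ln (partition_fun (w j) (A j) x)) has_derivative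
        (\<lambda>v. \<Sum>j<s. t j * (gibbs_mean (w j) (A j) x \<bullet> v))) (at x)"
      by (intro has_derivative_sum has_derivative_mult_right has_derivative_ln_partition_fun w) auto
    from has_derivative_diff[OF this has_derivative_inner_right[OF has_derivative_ident]]
    show ?thesis
      by (simp add: f_def[abs_def] \<Phi>_def moment_map_def inner_sum_left)
  qed
  then have cont: "continuous_on S f" for S
    by (meson continuous_at_imp_continuous_on has_derivative_continuous)
  \<comment> \<open>Chosen so that \<open>f\<close> exceeds \<open>f 0\<close> outside the ball of
    radius \<open>R\<close>; a minimum on this ball is then a global one.\<close>
  define R where "R = (\<bar>f 0 + B\<bar> + 1) / r"
  have R: "R > 0" "f 0 < r * R - B" using r by (auto simp: R_def)
  obtain x0 where x0: "x0 \<in> cball 0 R" "\<And>x. x \<in> cball 0 R \<Longrightarrow> f x0 \<le> f x"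
    using continuous_attains_inf[of "cball 0 R" f] cont R by (auto simp: less_imp_le)
  have glob: "f x0 \<le> f x" for x
  proof (cases "x \<in> cball 0 R")
    case False
    then have "r * R \<le> r * norm x" using r by auto
    then have "f 0 < f x" using coerc[of x] R by linarith
    moreover have "f x0 \<le> f 0" using x0 R by auto
    ultimately show ?thesis by simp
  qed (use x0 in auto)
  have "(\<lambda>v. moment_map s w A t x0 \<bullet> v - p \<bullet> v) = (\<lambda>v. 0)"
    by (rule differential_zero_maxmin[of x0 UNIV, OF _ _ df]) (auto simp: glob)
  then have "(moment_map s w A t x0 - p) \<bullet> v = 0" for v
    by (metis inner_diff_left)
  then have "moment_map s w A t x0 = p" by (metis eq_iff_diff_eq_0 inner_eq_zero_iff)
  then show "p \<in> range (moment_map s w A t)" by blast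
qed

lemma moment_deriv_inner:
  "moment_deriv s w A t x v \<bullet> v = (\<Sum>j<s. t j * (\<Sum>a\<in>A j. gibbs (w j) (A j) x a *
     ((a - gibbs_mean (w j) (A j) x) \<bullet> v)\<^sup>2))"
  by (simp add: moment_deriv_def inner_sum_left power2_eq_square mult.assoc)

text \<open>Along the segment from \<open>x\<close> to \<open>y\<close> the component of the map in
  the direction \<open>v = y - x\<close> has as derivative a weighted sum of variances of
  \<open>v\<close>. If this sum vanished somewhere, every polytope with
  \<open>t j \<noteq> 0\<close> would lie in a hyperplane orthogonal to \<open>v\<close>, and the
  combination would have no interior. So the component increases strictly.\<close>

lemma inj_moment_map:
  assumes t: "\<And>j. j < s \<Longrightarrow> 0 \<le> t j"
    and int: "interior (minkowski_comb (weighted_polytopes s w A) t) \<noteq> {}"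
  shows "inj (moment_map s w A t)"
proof (rule injI, rule ccontr)
  let ?X = "minkowski_comb (weighted_polytopes s w A) t"
  fix x y assume eq: "moment_map s w A t x = moment_map s w A t y" and ne: "x \<noteq> y"
  define v where "v = y - x"
  have v: "v \<noteq> 0" using ne by (simp add: v_def)
  have pos: "0 < moment_deriv s w A t z v \<bullet> v" for z
  proof (rule ccontr)
    assume neg: "\<not> 0 < moment_deriv s w A t z v \<bullet> v"
    have nn: "0 \<le> gibbs (w j) (A j) z a * ((a - gibbs_mean (w j) (A j) z) \<bullet> v)\<^sup>2" if "j < s" "a \<in> A j" for j a
      using gibbs_nonneg[OF w] that by simp
    have nn2: "0 \<le> t j * (\<Sum>a\<in>A j. gibbs (w j) (A j) z a * ((a - gibbs_mean (w j) (A j) z) \<bullet> v)\<^sup>2)" if "j < s" for j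
      by (intro mult_nonneg_nonneg sum_nonneg nn t that)
    have "0 \<le> moment_deriv s w A t z v \<bullet> v"
      unfolding moment_deriv_inner by (rule sum_nonneg) (simp add: nn2)
    with neg have "moment_deriv s w A t z v \<bullet> v = 0" by simp
    then have z: "t j = 0 \<or> (\<Sum>a\<in>A j. gibbs (w j) (A j) z a * ((a - gibbs_mean (w j) (A j) z) \<bullet> v)\<^sup>2) = 0" if "j < s" for j
      using nn2 that unfolding moment_deriv_inner
      by (subst (asm) sum_nonneg_eq_0_iff) auto
    \<comment> \<open>The factor \<open>t j\<close> stays on both sides since a polytope with
      \<open>t j = 0\<close> may have any extent in the direction \<open>v\<close>.\<close>
    have flat: "t j * (v \<bullet> b) = t j * (v \<bullet> gibbs_mean (w j) (A j) z)"
      if j: "j < s" and b: "b \<in> convex hull (weight_support (w j) (A j))" for j b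
    proof (cases "t j = 0")
      case False
      have "finite (A j)" using w[OF j] by (simp add: weight_on_def)
      then have 0: "gibbs (w j) (A j) z a * ((a - gibbs_mean (w j) (A j) z) \<bullet> v)\<^sup>2 = 0" if "a \<in> A j" for a
        using z[OF j] False nn[OF j] that by (auto simp: sum_nonneg_eq_0_iff)
      have "v \<bullet> a = v \<bullet> gibbs_mean (w j) (A j) z" if "a \<in> weight_support (w j) (A j)" for a
        using 0[of a] that gibbs_pos_iff[OF w[OF j], of a z]
        by (auto simp: weight_support_def inner_diff_left inner_diff_right inner_commute)
      then have "weight_support (w j) (A j) \<subseteq> {u. v \<bullet> u = v \<bullet> gibbs_mean (w j) (A j) z}" by auto
      then have "convex hull (weight_support (w j) (A j)) \<subseteq> {u. v \<bullet> u = v \<bullet> gibbs_mean (w j) (A j) z}"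
        by (rule hull_minimal) (rule convex_hyperplane)
      then show ?thesis using b by auto
    qed simp
    have "?X \<subseteq> {u. v \<bullet> u = (\<Sum>j<s. t j * (v \<bullet> gibbs_mean (w j) (A j) z))}"
      unfolding weighted_polytopes_comb by (auto simp: inner_sum_right flat intro!: sum.cong)
    then have "interior ?X \<subseteq> interior {u. v \<bullet> u = (\<Sum>j<s. t j * (v \<bullet> gibbs_mean (w j) (A j) z))}"
      by (rule interior_mono)
    then show False using int v by (simp add: interior_hyperplane)
  qed
  define \<psi> where "\<psi> r = moment_map s w A t (x + r *\<^sub>R v) \<bullet> v" for r
  have d: "(\<psi> has_real_derivative moment_deriv s w A t (x + r *\<^sub>R v) v \<bullet> v) (at r)" for r
  proof -
    have 1: "((\<lambda>r. x + r *\<^sub>R v) has_derivative (\<lambda>h. h *\<^sub>R v)) (at r)"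
      by (auto intro!: derivative_eq_intros)
    have "(\<psi> has_derivative (\<lambda>h. moment_deriv s w A t (x + r *\<^sub>R v) (h *\<^sub>R v) \<bullet> v)) (at r)"
      unfolding \<psi>_def
      by (rule has_derivative_inner_left, rule has_derivative_compose[OF 1 has_derivative_moment_map])
    moreover have "linear (moment_deriv s w A t (x + r *\<^sub>R v))"
      using has_derivative_moment_map has_derivative_linear by blast
    ultimately show ?thesis
      by (simp add: has_field_derivative_def linear_cmul fun_eq_iff mult_commute_abs)
  qed
  have "\<psi> 0 < \<psi> 1"
    by (rule DERIV_pos_imp_increasing) (use d pos in auto)
  then show False using eq by (simp add: \<psi>_def v_def)
qed

text \<open>A hyperplane with normal \<open>a\<close> that contains the combination also contains
  the range of the map, so all values of the derivative are orthogonal to \<open>a\<close> and it is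
  not onto. In the flat case the determinant therefore vanishes, in agreement with the zero
  volume.\<close>

lemma moment_deriv_not_inj:
  assumes int: "interior (minkowski_comb (weighted_polytopes s w A) t) = {}"
  shows "\<not> inj (moment_deriv s w A t x)"
proof
  let ?X = "minkowski_comb (weighted_polytopes s w A) t"
  assume inj: "inj (moment_deriv s w A t x)"
  have lin: "linear (moment_deriv s w A t x)"
    using has_derivative_moment_map has_derivative_linear by blast
  obtain a b where ab: "a \<noteq> 0" "?X \<subseteq> {x. a \<bullet> x = b}"
    using empty_interior_subset_hyperplane[OF convex_comb_polytopes int] by blast
  have "((\<lambda>x. a \<bullet> moment_map s w A t x) has_derivative (\<lambda>v. a \<bullet> moment_deriv s w A t x v)) (at x)"
    by (rule has_derivative_inner_right has_derivative_moment_map)+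
  moreover have "(\<lambda>x. a \<bullet> moment_map s w A t x) = (\<lambda>x. b)"
    using ab moment_map_in_comb by blast
  ultimately have "(\<lambda>v. a \<bullet> moment_deriv s w A t x v) = (\<lambda>v. 0)"
    using has_derivative_unique has_derivative_const by metis
  moreover obtain v where "moment_deriv s w A t x v = a"
    using linear_injective_imp_surjective[OF lin inj] by (metis surjD)
  ultimately show False using ab(1) by (metis inner_eq_zero_iff)
qed

end

section \<open>The volume polynomial of polytopes\<close>

lemma prod_eq_prod_power_card:
  fixes t :: "nat \<Rightarrow> real" and g :: "'n::finite \<Rightarrow> nat"
  assumes "\<And>i. g i < s"
  shows "(\<Prod>i\<in>UNIV. t (g i)) = (\<Prod>j<s. t j ^ card {i. g i = j})"
proof -
  have "(\<Prod>i\<in>UNIV. t (g i)) = (\<Prod>j<s. \<Prod>i | i \<in> UNIV \<and> g i = j. t (g i))"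
    by (rule prod.group[symmetric]) (use assms in auto)
  also have "\<dots> = (\<Prod>j<s. t j ^ card {i. g i = j})"
    by (intro prod.cong) auto
  finally show ?thesis .
qed

text \<open>The exponent list of the monomial that is the product of all
  \<open>t (g i)\<close>.\<close>

definition level_counts :: "nat \<Rightarrow> ('n::finite \<Rightarrow> nat) \<Rightarrow> nat list" where
  "level_counts s g = map (\<lambda>j. card {i. g i = j}) [0..<s]"

lemma level_counts_in_multi_indices:
  fixes g :: "'n::finite \<Rightarrow> nat"
  assumes "\<And>i. g i < s"
  shows "level_counts s g \<in> multi_indices s CARD('n)"
proof -
  have "sum_list (level_counts s g) = (\<Sum>j<s. card {i. g i = j})"
    unfolding level_counts_def by (simp add: sum_list_sum_nth atLeast0LessThan)
  also have "\<dots> = (\<Sum>j<s. \<Sum>i | i \<in> UNIV \<and> g i = j. 1)" by simp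
  also have "\<dots> = (\<Sum>i\<in>(UNIV :: 'n set). 1)"
    by (rule sum.group[of UNIV "{..<s}" g "\<lambda>_. 1"]) (use assms in auto)
  finally show ?thesis by (simp add: multi_indices_def level_counts_def)
qed

text \<open>The labels of the summands of the expanded determinant: each row receives a body and a
  point belonging to it.\<close>

definition gibbs_indices :: "nat \<Rightarrow> (nat \<Rightarrow> (real ^ 'n) set) \<Rightarrow> ('n \<Rightarrow> nat \<times> (real ^ 'n)) set" where
  "gibbs_indices s A = {f. \<forall>i. f i \<in> Sigma {..<s} A}"

text \<open>What remains of such a summand once the factors \<open>t\<close> are taken out. The
  square and the probabilities make it nonnegative.\<close>

definition gibbs_term :: "(nat \<Rightarrow> real ^ 'n \<Rightarrow> real) \<Rightarrow> (nat \<Rightarrow> (real ^ 'n) set)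
    \<Rightarrow> ('n \<Rightarrow> nat \<times> (real ^ 'n)) \<Rightarrow> real ^ 'n \<Rightarrow> real" where
  "gibbs_term w A f x =
     (\<Prod>i\<in>UNIV. gibbs (w (fst (f i))) (A (fst (f i))) x (snd (f i)))
     * (det (\<chi> i. snd (f i) - gibbs_mean (w (fst (f i))) (A (fst (f i))) x))\<^sup>2 / fact CARD('n)"

text \<open>Up to the multinomial normalisation, this is the mixed discriminant of the covariance matrices
  of the Gibbs measures.\<close>

definition gibbs_disc :: "nat \<Rightarrow> (nat \<Rightarrow> real ^ 'n \<Rightarrow> real) \<Rightarrow> (nat \<Rightarrow> (real ^ 'n) set)
    \<Rightarrow> nat list \<Rightarrow> real ^ 'n \<Rightarrow> real" where
  "gibbs_disc s w A e x =
     (\<Sum>f | f \<in> gibbs_indices s A \<and> level_counts s (fst \<circ> f) = e. gibbs_term w A f x)"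

lemma gibbs_indicesD:
  assumes "f \<in> gibbs_indices s A"
  shows "fst (f i) < s" "snd (f i) \<in> A (fst (f i))"
proof -
  have "f i \<in> Sigma {..<s} A" using assms by (simp add: gibbs_indices_def)
  then show "fst (f i) < s" "snd (f i) \<in> A (fst (f i))" by (cases "f i"; auto)+
qed

lemma finite_gibbs_indices:
  fixes A :: "nat \<Rightarrow> (real ^ 'n) set"
  assumes "\<And>j. j < s \<Longrightarrow> finite (A j)"
  shows "finite (gibbs_indices s A)"
proof -
  have "gibbs_indices s A = PiE UNIV (\<lambda>_. Sigma {..<s} A)"
    by (auto simp: gibbs_indices_def PiE_def)
  then show ?thesis using assms by (auto intro!: finite_PiE)
qed

text \<open>The matrix is a weighted Gram matrix indexed by pairs of a body and one of its points,
  with the centred points as vectors and \<open>t\<close> times the Gibbs probabilities as weights.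
  Grouping the labels by their exponent list collects the monomials in \<open>t\<close>.\<close>

lemma det_moment_deriv:
  fixes A :: "nat \<Rightarrow> (real ^ 'n) set"
  assumes "\<And>j. j < s \<Longrightarrow> finite (A j)"
  shows "det (matrix (moment_deriv s w A t x))
    = (\<Sum>e\<in>multi_indices s CARD('n). gibbs_disc s w A e x * (\<Prod>j<s. t j ^ (e ! j)))"
proof -
  define I where "I = Sigma {..<s} A"
  define b where "b k = snd k - gibbs_mean (w (fst k)) (A (fst k)) x" for k :: "nat \<times> (real ^ 'n)"
  define c where "c k = t (fst k) * gibbs (w (fst k)) (A (fst k)) x (snd k)" for k :: "nat \<times> (real ^ 'n)"
  have fin: "finite I" using assms by (auto simp: I_def)
  have "matrix (moment_deriv s w A t x) = (\<chi> i j. \<Sum>k\<in>I. c k * b k $ i * b k $ j)"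
    using assms unfolding I_def
    by (simp add: matrix_def moment_deriv_def vec_eq_iff inner_axis c_def b_def
        sum_distrib_left sum.Sigma split_def ac_simps)
  then have "det (matrix (moment_deriv s w A t x))
      = (\<Sum>f\<in>gibbs_indices s A. (\<Prod>i\<in>UNIV. c (f i)) * (det (\<chi> i. b (f i)))\<^sup>2 / fact CARD('n))"
    using det_weighted_gram[OF fin, of c b]
    by (simp add: sum_divide_distrib gibbs_indices_def I_def)
  also have "\<dots> = (\<Sum>f\<in>gibbs_indices s A. gibbs_term w A f x * (\<Prod>i\<in>UNIV. t ((fst \<circ> f) i)))"
    by (simp add: gibbs_term_def c_def b_def prod.distrib ac_simps)
  also have "\<dots> = (\<Sum>f\<in>gibbs_indices s A. gibbs_term w A f x * (\<Prod>j<s. t j ^ (level_counts s (fst \<circ> f) ! j)))"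
  proof (rule sum.cong[OF refl])
    fix f assume "f \<in> gibbs_indices s A"
    then have "(fst \<circ> f) i < s" for i by (simp add: gibbs_indicesD)
    from prod_eq_prod_power_card[of "fst \<circ> f", OF this, of t]
    show "gibbs_term w A f x * (\<Prod>i\<in>UNIV. t ((fst \<circ> f) i))
        = gibbs_term w A f x * (\<Prod>j<s. t j ^ (level_counts s (fst \<circ> f) ! j))"
      by (simp add: level_counts_def)
  qed
  also have "\<dots> = (\<Sum>e\<in>multi_indices s CARD('n). \<Sum>f | f \<in> gibbs_indices s A \<and> level_counts s (fst \<circ> f) = e.
      gibbs_term w A f x * (\<Prod>j<s. t j ^ (level_counts s (fst \<circ> f) ! j)))"
  proof (rule sum.group[symmetric])
    show "(\<lambda>f. level_counts s (fst \<circ> f)) ` gibbs_indices s A \<subseteq> multi_indices s CARD('n)"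
      by (auto intro!: level_counts_in_multi_indices simp: gibbs_indicesD)
  qed (use assms finite_gibbs_indices finite_multi_indices in auto)
  also have "\<dots> = (\<Sum>e\<in>multi_indices s CARD('n). gibbs_disc s w A e x * (\<Prod>j<s. t j ^ (e ! j)))"
    by (intro sum.cong refl) (simp add: gibbs_disc_def sum_distrib_right)
  finally show ?thesis .
qed

context
  fixes s :: nat and w :: "nat \<Rightarrow> real ^ 'n \<Rightarrow> real" and A :: "nat \<Rightarrow> (real ^ 'n) set"
  assumes w: "\<And>j. j < s \<Longrightarrow> weight_on (w j) (A j)"
begin

lemma gibbs_term_nonneg:
  assumes "f \<in> gibbs_indices s A"
  shows "0 \<le> gibbs_term w A f x"
  unfolding gibbs_term_def using gibbs_nonneg[OF w] gibbs_indicesD[OF assms]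
  by (intro divide_nonneg_nonneg mult_nonneg_nonneg prod_nonneg) auto

lemma gibbs_disc_nonneg: "0 \<le> gibbs_disc s w A e x"
  unfolding gibbs_disc_def by (intro sum_nonneg gibbs_term_nonneg) simp

lemma gibbs_term_measurable:
  assumes "f \<in> gibbs_indices s A"
  shows "gibbs_term w A f \<in> borel_measurable borel"
proof -
  have w': "weight_on (w (fst (f i))) (A (fst (f i)))" for i
    using w gibbs_indicesD[OF assms] by blast
  have 1: "continuous_on UNIV (\<lambda>x. gibbs (w (fst (f i))) (A (fst (f i))) x a)" for i a
    using has_derivative_continuous[OF has_derivative_gibbs[OF w']]
    by (intro continuous_at_imp_continuous_on) blast
  have 2: "continuous_on UNIV (\<lambda>x. gibbs_mean (w (fst (f i))) (A (fst (f i))) x)" for i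
    using has_derivative_continuous[OF has_derivative_gibbs_mean[OF w']]
    by (intro continuous_at_imp_continuous_on) blast
  have "continuous_on UNIV (gibbs_term w A f)"
    unfolding gibbs_term_def[abs_def] det_def
    by (intro continuous_intros 1 2) auto
  then show ?thesis by (rule borel_measurable_continuous_onI)
qed

lemma gibbs_disc_measurable: "gibbs_disc s w A e \<in> borel_measurable borel"
  unfolding gibbs_disc_def[abs_def] by (intro borel_measurable_sum gibbs_term_measurable) simp

end

text \<open>Extended nonnegative values are used because finiteness becomes known only through the
  volume formula.\<close>

definition disc_integral :: "nat \<Rightarrow> (nat \<Rightarrow> real ^ 'n \<Rightarrow> real) \<Rightarrow> (nat \<Rightarrow> (real ^ 'n) set) \<Rightarrow> nat list \<Rightarrow> ennreal" where
  "disc_integral s w A e = (\<integral>\<^sup>+x. ennreal (gibbs_disc s w A e x) \<partial>lborel)"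

lemma vol_weighted_polytopes_ennreal:
  fixes A :: "nat \<Rightarrow> (real ^ 'n::{finite,wellorder}) set"
  assumes w: "\<And>j. j < s \<Longrightarrow> weight_on (w j) (A j)" and t: "\<And>j. j < s \<Longrightarrow> 0 \<le> t j"
  shows "ennreal (vol (minkowski_comb (weighted_polytopes s w A) t))
    = (\<Sum>e\<in>multi_indices s CARD('n). disc_integral s w A e * ennreal (\<Prod>j<s. t j ^ (e ! j)))"
proof -
  let ?X = "minkowski_comb (weighted_polytopes s w A) t"
  let ?D = "\<lambda>x. det (matrix (moment_deriv s w A t x))"
  have fin: "finite (A j)" if "j < s" for j using w[OF that] by (simp add: weight_on_def)
  have det: "?D x = (\<Sum>e\<in>multi_indices s CARD('n). gibbs_disc s w A e x * (\<Prod>j<s. t j ^ (e ! j)))" for x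
    by (rule det_moment_deriv) (rule fin)
  have tp: "0 \<le> (\<Prod>j<s. t j ^ (e ! j))" for e :: "nat list"
    using t by (auto intro!: prod_nonneg)
  have Dnn: "0 \<le> ?D x" for x
    unfolding det using gibbs_disc_nonneg[of s w A, OF w] t
    by (auto intro!: sum_nonneg mult_nonneg_nonneg prod_nonneg)
  have Dmeas: "?D \<in> borel_measurable borel"
    unfolding det using gibbs_disc_measurable[of s w A, OF w]
    by (intro borel_measurable_sum borel_measurable_times) auto
  have "ennreal (vol ?X) = (\<integral>\<^sup>+x. ennreal (?D x) \<partial>lborel)"
  proof (cases "interior ?X = {}")
    case True
    have "?D x = 0" for x
    proof -
      have "linear (moment_deriv s w A t x)"
        using has_derivative_moment_map[of s w A, OF w] has_derivative_linear by blast
      then show ?thesis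
        using moment_deriv_not_inj[of s w A t x, OF w True] det_nz_iff_inj by blast
    qed
    moreover have "vol ?X = 0"
      using True convex_comb_polytopes[of s w A t, OF w] negligible_convex_interior negligible_imp_measure0 by blast
    ultimately show ?thesis by simp
  next
    case False
    let ?G = "moment_map s w A t"
    have X: "?X \<in> lmeasurable"
      using compact_comb_polytopes[of s w A t, OF w] by (rule lmeasurable_compact)
    have sub: "interior ?X \<subseteq> range ?G" "range ?G \<subseteq> ?X"
      using interior_subset_range_moment_map[of s w A t, OF w t] moment_map_in_comb[of s w A, OF w] by auto
    \<comment> \<open>The range lies between the interior and the compact convex set itself, so it
      can miss only frontier points.\<close>
    have neg: "negligible (?X - range ?G \<union> (range ?G - ?X))"
      by (rule negligible_subset[OF negligible_convex_frontier[OF convex_comb_polytopes[of s w A t, OF w]]])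
        (use sub closure_subset[of ?X] in \<open>auto simp: frontier_def\<close>)
    have "range ?G \<in> lmeasurable" "measure lebesgue (range ?G) = vol ?X"
      using lmeasurable_negligible_symdiff[OF X neg] measure_negligible_symdiff[OF X neg] by auto
    then have "((\<lambda>x. \<bar>?D x\<bar>) has_integral vol ?X) UNIV"
      using has_measure_differentiable_image[of UNIV ?G "moment_deriv s w A t" "vol ?X"]
        has_derivative_moment_map[of s w A, OF w] inj_moment_map[of s w A t, OF w t False] by auto
    then have "(?D has_integral vol ?X) UNIV" using Dnn by simp
    then show ?thesis
      using nn_integral_has_integral_lborel[OF Dmeas Dnn] by simp
  qed
  also have "\<dots> = (\<integral>\<^sup>+x. (\<Sum>e\<in>multi_indices s CARD('n). ennreal (gibbs_disc s w A e x) * ennreal (\<Prod>j<s. t j ^ (e ! j))) \<partial>lborel)"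
    unfolding det using gibbs_disc_nonneg[of s w A, OF w] tp
    by (simp add: ennreal_mult[symmetric] sum_ennreal)
  also have "\<dots> = (\<Sum>e\<in>multi_indices s CARD('n). disc_integral s w A e * ennreal (\<Prod>j<s. t j ^ (e ! j)))"
    unfolding disc_integral_def using gibbs_disc_measurable[of s w A, OF w]
    by (subst nn_integral_sum) (auto simp: nn_integral_multc)
  finally show ?thesis .
qed

text \<open>The prefactor is the reciprocal of the multinomial coefficient in
  \<open>mixed_volume_coeffs\<close>.\<close>

definition disc_coeff :: "nat \<Rightarrow> (nat \<Rightarrow> real ^ 'n \<Rightarrow> real) \<Rightarrow> (nat \<Rightarrow> (real ^ 'n) set) \<Rightarrow> nat list \<Rightarrow> real" where
  "disc_coeff s w A e = (\<Prod>j<s. fact (e ! j)) / fact CARD('n) * enn2real (disc_integral s w A e)"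

lemma disc_coeff_nonneg: "0 \<le> disc_coeff s w A e"
  by (simp add: disc_coeff_def prod_nonneg)

text \<open>With all \<open>t j = 1\<close> every monomial equals one, so these nonnegative
  integrals add up to a finite volume.\<close>

lemma disc_integral_finite:
  fixes A :: "nat \<Rightarrow> (real ^ 'n::{finite,wellorder}) set"
  assumes w: "\<And>j. j < s \<Longrightarrow> weight_on (w j) (A j)" and e: "e \<in> multi_indices s CARD('n)"
  shows "disc_integral s w A e < top"
proof -
  have "disc_integral s w A e \<le> (\<Sum>e\<in>multi_indices s CARD('n). disc_integral s w A e)"
    using e finite_multi_indices by (intro member_le_sum) auto
  also have "\<dots> = ennreal (vol (minkowski_comb (weighted_polytopes s w A) (\<lambda>_. 1)))"
    using vol_weighted_polytopes_ennreal[of s w A "\<lambda>_. 1", OF w] by simp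
  finally show ?thesis by (simp add: le_less_trans)
qed

lemma mixed_volume_coeffs_weighted_polytopes:
  fixes A :: "nat \<Rightarrow> (real ^ 'n::{finite,wellorder}) set"
  assumes w: "\<And>j. j < s \<Longrightarrow> weight_on (w j) (A j)"
  shows "mixed_volume_coeffs (weighted_polytopes s w A) (disc_coeff s w A)"
  unfolding mixed_volume_coeffs_def
proof (intro allI impI)
  have len: "length (weighted_polytopes s w A) = s" by (simp add: weighted_polytopes_def)
  fix t :: "nat \<Rightarrow> real" assume "\<forall>j<length (weighted_polytopes s w A). 0 \<le> t j"
  then have t: "0 \<le> t j" if "j < s" for j using that len by simp
  have tp: "0 \<le> (\<Prod>j<s. t j ^ (e ! j))" for e :: "nat list"
    using t by (auto intro!: prod_nonneg)
  have fin: "disc_integral s w A e < top" if "e \<in> multi_indices s CARD('n)" for e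
    using w that by (rule disc_integral_finite)
  have "ennreal (vol (minkowski_comb (weighted_polytopes s w A) t))
      = (\<Sum>e\<in>multi_indices s CARD('n). disc_integral s w A e * ennreal (\<Prod>j<s. t j ^ (e ! j)))"
    using w t by (rule vol_weighted_polytopes_ennreal)
  also have "\<dots> = (\<Sum>e\<in>multi_indices s CARD('n). ennreal (enn2real (disc_integral s w A e) * (\<Prod>j<s. t j ^ (e ! j))))"
    by (intro sum.cong refl) (simp add: ennreal_mult tp fin)
  also have "\<dots> = ennreal (\<Sum>e\<in>multi_indices s CARD('n). enn2real (disc_integral s w A e) * (\<Prod>j<s. t j ^ (e ! j)))"
    by (intro sum_ennreal mult_nonneg_nonneg prod_nonneg) (auto simp: t)
  finally have "vol (minkowski_comb (weighted_polytopes s w A) t)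
    = (\<Sum>e\<in>multi_indices s CARD('n). enn2real (disc_integral s w A e) * (\<Prod>j<s. t j ^ (e ! j)))"
    by (subst (asm) ennreal_inj) (auto intro!: sum_nonneg mult_nonneg_nonneg prod_nonneg simp: t)
  then show "vol (minkowski_comb (weighted_polytopes s w A) t) =
      (\<Sum>e\<in>multi_indices (length (weighted_polytopes s w A)) CARD('n).
         fact CARD('n) / (\<Prod>j<length (weighted_polytopes s w A). fact (e ! j)) * disc_coeff s w A e
         * (\<Prod>j<length (weighted_polytopes s w A). t j ^ (e ! j)))"
    by (simp add: len disc_coeff_def)
qed

section \<open>Uniqueness and convergence of coefficients\<close>

text \<open>This one fact serves both the passage from polytopes to convex bodies and the uniqueness
  of the coefficients.\<close>

lemma polynomial_coeffs_convergent:
  fixes d :: "nat \<Rightarrow> nat \<Rightarrow> real"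
  assumes "\<And>x. 0 < x \<Longrightarrow> convergent (\<lambda>m. \<Sum>k\<le>N. d m k * x ^ k)" and "k \<le> N"
  shows "convergent (\<lambda>m. d m k)"
  using assms
proof (induction N arbitrary: d k)
  case 0
  then show ?case using "0.prems"(1)[of 1] by simp
next
  case (Suc N)
  text \<open>Passing from \<open>p(x)\<close> to \<open>p(2x) - 2\<^bsup>N+1\<^esup> p(x)\<close> removes the leading coefficient.\<close>
  have low: "convergent (\<lambda>m. d m k)" if "k \<le> N" for k
  proof -
    have "convergent (\<lambda>m. \<Sum>k\<le>N. d m k * (2 ^ k - 2 ^ Suc N) * x ^ k)" if x: "0 < x" for x :: real
    proof -
      have "convergent (\<lambda>m. (\<Sum>k\<le>Suc N. d m k * (2 * x) ^ k) - 2 ^ Suc N * (\<Sum>k\<le>Suc N. d m k * x ^ k))"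
        using x by (intro convergent_diff convergent_mult Suc.prems convergent_const) auto
      moreover have "(\<Sum>k\<le>Suc N. d m k * (2 * x) ^ k) - 2 ^ Suc N * (\<Sum>k\<le>Suc N. d m k * x ^ k)
          = (\<Sum>k\<le>N. d m k * (2 ^ k - 2 ^ Suc N) * x ^ k)" for m
        unfolding sum_distrib_left sum_subtractf[symmetric]
        by (simp add: power_mult_distrib algebra_simps)
      ultimately show ?thesis by simp
    qed
    from Suc.IH[OF this that] have "convergent (\<lambda>m. d m k * (2 ^ k - 2 ^ Suc N))" .
    moreover have "(2::real) ^ k - 2 ^ Suc N \<noteq> 0"
      using power_strict_increasing[of k "Suc N" "2::real"] that by simp
    ultimately show ?thesis using convergent_mult_const_right_iff by blast
  qed
  show ?case
  proof (cases "k \<le> N")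
    case False
    then have k: "k = Suc N" using Suc.prems by simp
    have "convergent (\<lambda>m. (\<Sum>k\<le>Suc N. d m k * 1 ^ k) - (\<Sum>k\<le>N. d m k))"
      by (intro convergent_diff Suc.prems(1) convergent_sum low) auto
    then show ?thesis by (simp add: k)
  qed (rule low)
qed

text \<open>For the Kronecker substitution: under \<open>t j = x ^ (b ^ j)\<close> the monomial with
  exponent list \<open>e\<close> becomes \<open>x ^ radix_value b e\<close>. A base larger than all
  exponents keeps distinct monomials apart.\<close>

primrec radix_value :: "nat \<Rightarrow> nat list \<Rightarrow> nat" where
  "radix_value b [] = 0"
| "radix_value b (x # xs) = x + b * radix_value b xs"

lemma radix_value_inject:
  assumes "length xs = length ys" and "set xs \<subseteq> {..<b}" "set ys \<subseteq> {..<b}" "radix_value b xs = radix_value b ys"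
  shows "xs = ys"
  using assms
proof (induction xs ys rule: list_induct2)
  case (Cons x xs y ys)
  have "(x + b * radix_value b xs) mod b = (y + b * radix_value b ys) mod b"
    using Cons.prems(3) by simp
  then have "x = y" using Cons.prems(1,2) by simp
  moreover have "0 < b" using Cons.prems by auto
  ultimately show ?case using Cons by auto
qed simp

text \<open>The factor \<open>c\<close> is there for the induction, which turns it into
  \<open>c * b\<close> when it passes to the tail.\<close>

lemma prod_power_radix_value:
  fixes x :: "'a::comm_monoid_mult"
  shows "(\<Prod>j<length e. (x ^ (c * b ^ j)) ^ (e ! j)) = x ^ (c * radix_value b e)"
proof (induction e arbitrary: c)
  case (Cons k e)
  have "(\<Prod>j<length (k # e). (x ^ (c * b ^ j)) ^ ((k # e) ! j))
      = (x ^ c) ^ k * (\<Prod>j<length e. (x ^ (c * b * b ^ j)) ^ (e ! j))"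
    by (simp add: prod.lessThan_Suc_shift mult.assoc del: prod.lessThan_Suc)
  then show ?case
    unfolding Cons.IH by (simp add: power_mult[symmetric] power_add[symmetric] algebra_simps)
qed simp

lemma multi_indices_bounded: "e \<in> multi_indices s n \<Longrightarrow> set e \<subseteq> {..<Suc n}"
  by (auto simp: multi_indices_def less_Suc_eq_le member_le_sum_list)

text \<open>Kronecker substitution reduces the claim to one variable. Exponents are at most
  \<open>n\<close>, so the base \<open>Suc n\<close> makes the encoding injective.\<close>

lemma multi_coeffs_convergent:
  fixes d :: "nat \<Rightarrow> nat list \<Rightarrow> real"
  assumes conv: "\<And>t. (\<And>j. j < s \<Longrightarrow> 0 \<le> t j) \<Longrightarrow>
      convergent (\<lambda>m. \<Sum>e\<in>multi_indices s n. d m e * (\<Prod>j<s. t j ^ (e ! j)))"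
    and e: "e \<in> multi_indices s n"
  shows "convergent (\<lambda>m. d m e)"
proof -
  define M where "M = multi_indices s n"
  define rv where "rv = radix_value (Suc n)"
  define N where "N = Max (rv ` M)"
  have fin: "finite M" by (simp add: M_def finite_multi_indices)
  have inj: "inj_on rv M"
  proof (rule inj_onI)
    fix x y assume xy: "x \<in> M" "y \<in> M" and "rv x = rv y"
    then show "x = y"
      using radix_value_inject[of x y "Suc n"] multi_indices_bounded
      unfolding rv_def M_def by (simp add: multi_indices_def)
  qed
  \<comment> \<open>The coefficient of \<open>x ^ k\<close> after the substitution; by injectivity
    of \<open>rv\<close> at most one \<open>e\<close> contributes to it.\<close>
  define D where "D m k = (\<Sum>e | e \<in> M \<and> rv e = k. d m e)" for m k
  have "convergent (\<lambda>m. \<Sum>k\<le>N. D m k * x ^ k)" if x: "0 < x" for x :: real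
  proof -
    have "(\<Sum>e\<in>M. d m e * (\<Prod>j<s. (x ^ (Suc n ^ j)) ^ (e ! j))) = (\<Sum>k\<le>N. D m k * x ^ k)" for m
    proof -
      have "(\<Sum>e\<in>M. d m e * (\<Prod>j<s. (x ^ (Suc n ^ j)) ^ (e ! j))) = (\<Sum>e\<in>M. d m e * x ^ rv e)"
      proof (rule sum.cong[OF refl])
        fix e assume "e \<in> M"
        then have "length e = s" by (simp add: M_def multi_indices_def)
        then show "d m e * (\<Prod>j<s. (x ^ (Suc n ^ j)) ^ (e ! j)) = d m e * x ^ rv e"
          using prod_power_radix_value[of x 1 "Suc n" e] by (simp add: rv_def)
      qed
      also have "\<dots> = (\<Sum>k\<le>N. \<Sum>e | e \<in> M \<and> rv e = k. d m e * x ^ rv e)"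
        by (rule sum.group[symmetric]) (use fin in \<open>auto simp: N_def\<close>)
      also have "\<dots> = (\<Sum>k\<le>N. D m k * x ^ k)"
        by (simp add: D_def sum_distrib_right)
      finally show ?thesis .
    qed
    moreover have "convergent (\<lambda>m. \<Sum>e\<in>M. d m e * (\<Prod>j<s. (x ^ (Suc n ^ j)) ^ (e ! j)))"
      unfolding M_def by (rule conv) (use x in auto)
    ultimately show ?thesis by simp
  qed
  moreover have "rv e \<le> N" using e fin by (auto simp: N_def M_def)
  ultimately have "convergent (\<lambda>m. D m (rv e))"
    by (rule polynomial_coeffs_convergent)
  moreover have "{e'. e' \<in> M \<and> rv e' = rv e} = {e}"
    using inj e by (auto simp: M_def inj_on_def)
  ultimately show ?thesis by (simp add: D_def)
qed

text \<open>The sequence that alternates between \<open>c\<close> and \<open>d\<close> has constant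
  polynomial values, so its coefficients converge. Its even and odd subsequences are constant and
  must share the limit.\<close>

lemma multi_coeffs_unique:
  fixes c d :: "nat list \<Rightarrow> real"
  assumes eq: "\<And>t. (\<And>j. j < s \<Longrightarrow> 0 \<le> t j) \<Longrightarrow>
      (\<Sum>e\<in>multi_indices s n. c e * (\<Prod>j<s. t j ^ (e ! j)))
        = (\<Sum>e\<in>multi_indices s n. d e * (\<Prod>j<s. t j ^ (e ! j)))"
    and e: "e \<in> multi_indices s n"
  shows "c e = d e"
proof -
  define g where "g m = (if even m then c else d)" for m :: nat
  have "convergent (\<lambda>m. g m e)"
  proof (rule multi_coeffs_convergent[where s = s and n = n and d = g, OF _ e])
    fix t :: "nat \<Rightarrow> real" assume "\<And>j. j < s \<Longrightarrow> 0 \<le> t j"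
    note eq' = eq[OF this]
    have "(\<Sum>e\<in>multi_indices s n. g m e * (\<Prod>j<s. t j ^ (e ! j)))
        = (\<Sum>e\<in>multi_indices s n. c e * (\<Prod>j<s. t j ^ (e ! j)))" for m
    proof (cases "even m")
      case True then show ?thesis by (simp only: g_def if_True)
    next
      case False then show ?thesis by (simp only: g_def if_False eq')
    qed
    then show "convergent (\<lambda>m. \<Sum>e\<in>multi_indices s n. g m e * (\<Prod>j<s. t j ^ (e ! j)))"
      by (simp only: convergent_const)
  qed
  then obtain l where l: "(\<lambda>m. g m e) \<longlonglongrightarrow> l" by (auto simp: convergent_def)
  have "(\<lambda>m. g (2 * m) e) \<longlonglongrightarrow> l" "(\<lambda>m. g (2 * m + 1) e) \<longlonglongrightarrow> l"
    using LIMSEQ_subseq_LIMSEQ[OF l, of "\<lambda>m. 2 * m"] LIMSEQ_subseq_LIMSEQ[OF l, of "\<lambda>m. 2 * m + 1"]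
    by (auto simp: strict_mono_def comp_def)
  then show ?thesis by (simp add: g_def LIMSEQ_const_iff)
qed

lemma mixed_volume_coeffs_unique:
  assumes c: "mixed_volume_coeffs (Ls :: (real ^ 'n) set list) c" and d: "mixed_volume_coeffs Ls d"
    and e: "e \<in> multi_indices (length Ls) CARD('n)"
  shows "c e = d e"
proof -
  let ?a = "\<lambda>e. fact CARD('n) / (\<Prod>j<length Ls. fact (e ! j)) :: real"
  have "?a e * c e = ?a e * d e"
    by (rule multi_coeffs_unique[OF _ e, of "\<lambda>e. ?a e * c e" "\<lambda>e. ?a e * d e"])
      (use c d in \<open>auto simp: mixed_volume_coeffs_def\<close>)
  then show ?thesis by simp
qed

lemma mixed_volume_eqI:
  assumes c: "mixed_volume_coeffs (Ls :: (real ^ 'n) set list) c"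
    and e: "e \<in> multi_indices (length Ls) CARD('n)"
  shows "mixed_volume Ls e = c e"
  unfolding mixed_volume_def
proof (rule the_equality)
  fix v assume "\<exists>c. mixed_volume_coeffs Ls c \<and> v = c e"
  then show "v = c e" using mixed_volume_coeffs_unique[OF _ c e] by blast
qed (use c in blast)

section \<open>Approximation of convex bodies by polytopes\<close>

lemma tendsto_det:
  fixes A :: "'m \<Rightarrow> real ^ 'n ^ 'n"
  assumes "\<And>i j. ((\<lambda>m. A m $ i $ j) \<longlongrightarrow> B $ i $ j) F"
  shows "((\<lambda>m. det (A m)) \<longlongrightarrow> det B) F"
  unfolding det_def by (intro tendsto_intros assms)

lemma tendsto_gibbs:
  assumes "weight_on w A" and "\<And>a. a \<in> A \<Longrightarrow> (\<lambda>m. W m a) \<longlonglongrightarrow> w a" and "a \<in> A"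
  shows "(\<lambda>m. gibbs (W m) A x a) \<longlonglongrightarrow> gibbs w A x a"
  unfolding gibbs_def partition_fun_def
  using partition_fun_pos[OF assms(1), of x] assms(2,3)
  by (intro tendsto_intros) (auto simp: partition_fun_def)

lemma tendsto_gibbs_mean:
  assumes "weight_on w A" and "\<And>a. a \<in> A \<Longrightarrow> (\<lambda>m. W m a) \<longlonglongrightarrow> w a"
  shows "(\<lambda>m. gibbs_mean (W m) A x) \<longlonglongrightarrow> gibbs_mean w A x"
  unfolding gibbs_mean_def using tendsto_gibbs[OF assms] by (intro tendsto_intros)

text \<open>For each \<open>x\<close> the integrand depends continuously on the weights. Only an
  inequality can be expected for the integrals, since mass may escape to infinity as weights tend to
  zero; this loss is what makes the smaller polytope get the smaller coefficient.\<close>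

lemma disc_integral_le_liminf:
  fixes A :: "nat \<Rightarrow> (real ^ 'n) set"
  assumes w: "\<And>j. j < s \<Longrightarrow> weight_on (w j) (A j)"
    and W: "\<And>m j. j < s \<Longrightarrow> weight_on (W m j) (A j)"
    and lim: "\<And>j a. j < s \<Longrightarrow> a \<in> A j \<Longrightarrow> (\<lambda>m. W m j a) \<longlonglongrightarrow> w j a"
  shows "disc_integral s w A e \<le> liminf (\<lambda>m. disc_integral s (W m) A e)"
proof -
  have "(\<lambda>m. gibbs_term (W m) A f x) \<longlonglongrightarrow> gibbs_term w A f x" if f: "f \<in> gibbs_indices s A" for f x
  proof -
    note fD = gibbs_indicesD[OF f]
    have mean: "(\<lambda>m. gibbs_mean (W m (fst (f i))) (A (fst (f i))) x) \<longlonglongrightarrow> gibbs_mean (w (fst (f i))) (A (fst (f i))) x" for i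
      by (intro tendsto_gibbs_mean w lim fD)
    show ?thesis unfolding gibbs_term_def
      by (intro tendsto_intros tendsto_gibbs tendsto_det w lim fD)
        (simp_all add: tendsto_intros mean)
  qed
  then have pt: "(\<lambda>m. ennreal (gibbs_disc s (W m) A e x)) \<longlonglongrightarrow> ennreal (gibbs_disc s w A e x)" for x
    unfolding gibbs_disc_def by (intro tendsto_ennrealI tendsto_sum) simp
  have "disc_integral s w A e = (\<integral>\<^sup>+x. liminf (\<lambda>m. ennreal (gibbs_disc s (W m) A e x)) \<partial>lborel)"
    unfolding disc_integral_def using lim_imp_Liminf[OF _ pt] by simp
  also have "\<dots> \<le> liminf (\<lambda>m. \<integral>\<^sup>+x. ennreal (gibbs_disc s (W m) A e x) \<partial>lborel)"
    using gibbs_disc_measurable[of s _ A, OF W] by (intro nn_integral_liminf) auto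
  finally show ?thesis by (simp add: disc_integral_def)
qed

text \<open>A smaller polytope is the limit of weights on the vertices of the larger one which
  degenerate to zero; Fatou's lemma then compares the coefficients.\<close>

lemma mixed_volume_coeffs_polytopes_mono:
  fixes A B :: "nat \<Rightarrow> (real ^ 'n::{finite,wellorder}) set"
  assumes AB: "\<And>j. j < s \<Longrightarrow> finite (A j) \<and> B j \<noteq> {} \<and> B j \<subseteq> A j"
    and c: "mixed_volume_coeffs (map (\<lambda>j. convex hull A j) [0..<s]) c"
    and d: "mixed_volume_coeffs (map (\<lambda>j. convex hull B j) [0..<s]) d"
    and e: "e \<in> multi_indices s CARD('n)"
  shows "d e \<le> c e"
proof -
  define W where "W m j a = (if a \<in> B j then 1 else inverse (real (Suc m)))" for m j a
  define w where "w j a = (if a \<in> B j then 1 else 0 :: real)" for j a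
  have W: "weight_on (W m j) (A j)" if "j < s" for m j
    using AB[OF that] by (auto simp: weight_on_def W_def)
  have w: "weight_on (w j) (A j)" if "j < s" for j
    using AB[OF that] by (auto simp: weight_on_def w_def)
  have lim: "(\<lambda>m. W m j a) \<longlonglongrightarrow> w j a" for j a
    unfolding W_def w_def using LIMSEQ_inverse_real_of_nat by simp
  have "weighted_polytopes s (W m) A = map (\<lambda>j. convex hull A j) [0..<s]" for m
    using AB by (auto simp: weighted_polytopes_def weight_support_def W_def intro!: arg_cong[of _ _ "(hull) convex"])
  then have cW: "disc_coeff s (W m) A e = c e" for m
    using mixed_volume_coeffs_unique[OF _ c] mixed_volume_coeffs_weighted_polytopes[of s "W m" A, OF W] e
    by simp
  have "weight_support (w j) (A j) = B j" if "j < s" for j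
    using AB[OF that] by (auto simp: weight_support_def w_def)
  then have "weighted_polytopes s w A = map (\<lambda>j. convex hull B j) [0..<s]"
    by (simp add: weighted_polytopes_def)
  then have dw: "disc_coeff s w A e = d e"
    using mixed_volume_coeffs_unique[OF _ d] mixed_volume_coeffs_weighted_polytopes[of s w A, OF w] e
    by simp
  define a :: real where "a = (\<Prod>j<s. fact (e ! j)) / fact CARD('n)"
  have a: "a > 0" by (simp add: a_def prod_pos)
  have fin: "disc_integral s (W m) A e < top" for m
    using W e by (rule disc_integral_finite)
  have cI: "disc_integral s (W m) A e = ennreal (c e / a)" for m
  proof -
    have "c e / a = enn2real (disc_integral s (W m) A e)"
      using a by (simp add: cW[of m, symmetric] disc_coeff_def a_def[symmetric])
    then show ?thesis using fin[of m] by simp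
  qed
  have c0: "0 \<le> c e" using cW[of 0] disc_coeff_nonneg by metis
  have "disc_integral s w A e \<le> liminf (\<lambda>m. disc_integral s (W m) A e)"
    using w W lim by (rule disc_integral_le_liminf)
  also have "\<dots> = ennreal (c e / a)" by (simp add: cI Liminf_const)
  finally have "enn2real (disc_integral s w A e) \<le> c e / a"
    using c0 a by (intro enn2real_leI) auto
  then show ?thesis
    using a by (simp add: dw[symmetric] disc_coeff_def a_def[symmetric] field_simps)
qed

section \<open>Exhaustion of convex bodies by polytopes\<close>

definition exhausts :: "(nat \<Rightarrow> 'a::real_normed_vector set) \<Rightarrow> 'a set \<Rightarrow> bool" where
  "exhausts A L \<longleftrightarrow> (\<forall>m. finite (A m) \<and> A m \<noteq> {} \<and> A m \<subseteq> L) \<and> mono A \<and> L \<subseteq> closure (\<Union>m. A m)"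

lemma convex_body_exhausts:
  assumes "convex_body (L :: 'a::euclidean_space set)"
  obtains A where "exhausts A L"
proof -
  obtain T where T: "countable T" "T \<subseteq> L" "L \<subseteq> closure T" using separable by metis
  have ne: "T \<noteq> {}" using T assms by (auto simp: convex_body_def)
  define A where "A m = from_nat_into T ` {..m}" for m :: nat
  have "(\<Union>m. A m) = range (from_nat_into T)" by (auto simp: A_def)
  then have U: "(\<Union>m. A m) = T" using T ne by (simp add: range_from_nat_into)
  have "mono A" by (auto simp: mono_def A_def)
  moreover have "A m \<subseteq> L" for m using U T by blast
  ultimately have "exhausts A L" using U T by (auto simp: exhausts_def A_def)
  then show thesis by (rule that)
qed

text \<open>Supplies exhaustions of two nested bodies that are nested at every stage.\<close>

lemma exhausts_Un:
  assumes A: "exhausts A L" and B: "exhausts B L'" and "L' \<subseteq> L"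
  shows "exhausts (\<lambda>m. A m \<union> B m) L"
proof -
  have "closure (\<Union>m. A m) \<subseteq> closure (\<Union>m. A m \<union> B m)"
    by (intro closure_mono) auto
  then have "L \<subseteq> closure (\<Union>m. A m \<union> B m)" using A unfolding exhausts_def by blast
  moreover have "A m \<union> B m \<subseteq> L" for m using assms unfolding exhausts_def by blast
  moreover have "mono (\<lambda>m. A m \<union> B m)"
    using A B unfolding exhausts_def mono_def by (simp add: le_supI1 le_supI2)
  ultimately show ?thesis using A B by (simp add: exhausts_def)
qed

text \<open>The polytope combinations increase to a convex set \<open>U\<close> that is dense in the
  limit \<open>Y\<close>. Hence \<open>Y\<close> exceeds \<open>U\<close> only by frontier points of
  \<open>U\<close>, a null set, and continuity of measure along increasing sequences
  applies.\<close>

lemma vol_exhausts: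
  fixes Ls :: "(real ^ 'n) set list"
  assumes Ls: "\<And>L. L \<in> set Ls \<Longrightarrow> convex_body L"
    and A: "\<And>j. j < length Ls \<Longrightarrow> exhausts (A j) (Ls ! j)"
  shows "(\<lambda>m. vol (minkowski_comb (map (\<lambda>j. convex hull A j m) [0..<length Ls]) t))
    \<longlonglongrightarrow> vol (minkowski_comb Ls t)"
proof -
  define s where "s = length Ls"
  define X where "X m = minkowski_comb (map (\<lambda>j. convex hull A j m) [0..<s]) t" for m
  define Y where "Y = minkowski_comb Ls t"
  have Xeq: "X m = {\<Sum>j<s. t j *\<^sub>R y j | y. \<forall>j<s. y j \<in> convex hull (A j m)}" for m
    unfolding X_def minkowski_comb_eq by simp
  have Yeq: "Y = {\<Sum>j<s. t j *\<^sub>R y j | y. \<forall>j<s. y j \<in> Ls ! j}"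
    unfolding Y_def minkowski_comb_eq s_def ..
  have A': "mono (A j)" "A j m \<subseteq> Ls ! j" "Ls ! j \<subseteq> closure (\<Union>m. A j m)" "finite (A j m)" if "j < s" for j m
    using A[of j] that by (auto simp: exhausts_def s_def)
  have convL: "convex (Ls ! j)" if "j < s" for j
    using Ls that by (auto simp: convex_body_def s_def)
  have mono: "incseq X"
  proof (rule monoI)
    fix m m' :: nat assume "m \<le> m'"
    then have "convex hull (A j m) \<subseteq> convex hull (A j m')" if "j < s" for j
      using A'(1)[OF that] by (intro hull_mono) (auto simp: mono_def)
    then show "X m \<subseteq> X m'" unfolding Xeq by blast
  qed
  have XY: "X m \<subseteq> Y" for m
  proof -
    have "convex hull (A j m) \<subseteq> Ls ! j" if "j < s" for j
      using A'(2)[OF that] convL[OF that] by (rule hull_minimal)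
    then show ?thesis unfolding Xeq Yeq by blast
  qed
  have convX: "convex (X m)" for m
    unfolding X_def by (intro convex_minkowski_comb) auto
  have compX: "compact (X m)" for m
    unfolding X_def using A'(4) by (intro compact_minkowski_comb) (auto intro!: finite_imp_compact_convex_hull)
  have compY: "compact Y"
    unfolding Y_def using Ls by (intro compact_minkowski_comb) (auto simp: convex_body_def)
  define U where "U = (\<Union>m. X m)"
  have convU: "convex U"
    unfolding U_def convex_alt
  proof safe
    fix x y u m m' assume xy: "x \<in> X m" "y \<in> X m'" and u: "0 \<le> u" "u \<le> (1::real)"
    have "x \<in> X (max m m')" "y \<in> X (max m m')"
      using xy incseqD[OF mono, of m "max m m'"] incseqD[OF mono, of m' "max m m'"] by auto
    then show "(1 - u) *\<^sub>R x + u *\<^sub>R y \<in> (\<Union>m. X m)"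
      using convX[of "max m m'"] u unfolding convex_alt by blast
  qed
  have "Y \<subseteq> closure U"
  proof
    fix z assume "z \<in> Y"
    then obtain y where z: "z = (\<Sum>j<s. t j *\<^sub>R y j)" and y: "\<And>j. j < s \<Longrightarrow> y j \<in> Ls ! j"
      unfolding Yeq by blast
    have "\<exists>q. (\<forall>k. q k \<in> (\<Union>m. A j m)) \<and> q \<longlonglongrightarrow> y j" if "j < s" for j
      using y[OF that] A'(3)[OF that] closure_sequential by blast
    then obtain q where q: "\<And>j k. j < s \<Longrightarrow> q j k \<in> (\<Union>m. A j m)" "\<And>j. j < s \<Longrightarrow> q j \<longlonglongrightarrow> y j"
      by metis
    have "(\<lambda>k. \<Sum>j<s. t j *\<^sub>R q j k) \<longlonglongrightarrow> z"
      unfolding z by (intro tendsto_intros q) auto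
    moreover have "(\<Sum>j<s. t j *\<^sub>R q j k) \<in> U" for k
    proof -
      have "\<forall>j. \<exists>m. j < s \<longrightarrow> q j k \<in> A j m" using q(1) by blast
      then obtain M where M: "\<And>j. j < s \<Longrightarrow> q j k \<in> A j (M j)" by metis
      \<comment> \<open>Each of the finitely many points occurs at some stage; this stage contains
        all of them because the exhaustions increase.\<close>
      define N where "N = Max (M ` {..<s})"
      have "q j k \<in> convex hull (A j N)" if "j < s" for j
      proof -
        have "M j \<le> N" using that by (auto simp: N_def)
        then have "A j (M j) \<subseteq> A j N" using A'(1)[OF that] by (auto simp: mono_def)
        then show ?thesis using M[OF that] by (auto intro: hull_inc)
      qed
      then have "(\<Sum>j<s. t j *\<^sub>R q j k) \<in> X N"
        unfolding Xeq by (intro CollectI exI[of _ "\<lambda>j. q j k"]) simp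
      then show ?thesis by (auto simp: U_def)
    qed
    ultimately show "z \<in> closure U"
      unfolding closure_sequential by (intro exI[of _ "\<lambda>k. \<Sum>j<s. t j *\<^sub>R q j k"]) blast
  qed
  then have neg: "negligible (Y - U \<union> (U - Y))"
    using XY interior_subset[of U] unfolding U_def[symmetric]
    by (intro negligible_subset[OF negligible_convex_frontier[OF convU]]) (auto simp: frontier_def U_def)
  have Ymeas: "Y \<in> lmeasurable" using compY by (rule lmeasurable_compact)
  have U: "U \<in> lmeasurable" "vol U = vol Y"
    using lmeasurable_negligible_symdiff[OF Ymeas neg] measure_negligible_symdiff[OF Ymeas neg] by auto
  have "(\<lambda>m. vol (X m)) \<longlonglongrightarrow> vol (\<Union>m. X m)"
  proof (rule Lim_measure_incseq)
    show "range X \<subseteq> sets lebesgue" using compX lmeasurable_compact by auto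
    show "emeasure lebesgue (\<Union>m. X m) \<noteq> \<infinity>"
      using U(1) unfolding U_def[symmetric] by (auto simp: fmeasurable_def)
  qed (rule mono)
  then show ?thesis using U(2) by (simp add: U_def X_def Y_def s_def)
qed

text \<open>The volumes converge for every admissible \<open>t\<close>, so the coefficients converge
  by \<open>multi_coeffs_convergent\<close>. At a list \<open>e\<close> outside the multi-indices
  \<open>lim\<close> may be unspecified, but such lists do not occur in the polynomial.\<close>

lemma mixed_volume_coeffs_limit:
  fixes Ls :: "(real ^ 'n) set list"
  assumes Ls: "\<And>L. L \<in> set Ls \<Longrightarrow> convex_body L"
    and A: "\<And>j. j < length Ls \<Longrightarrow> exhausts (A j) (Ls ! j)"
    and C: "\<And>m. mixed_volume_coeffs (map (\<lambda>j. convex hull A j m) [0..<length Ls]) (C m)"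
  shows "mixed_volume_coeffs Ls (\<lambda>e. lim (\<lambda>m. C m e))"
    and "e \<in> multi_indices (length Ls) CARD('n) \<Longrightarrow> convergent (\<lambda>m. C m e)"
proof -
  let ?s = "length Ls"
  let ?a = "\<lambda>e. fact CARD('n) / (\<Prod>j<?s. fact (e ! j)) :: real"
  let ?X = "\<lambda>m. minkowski_comb (map (\<lambda>j. convex hull A j m) [0..<?s])"
  have eq: "vol (?X m t) = (\<Sum>e\<in>multi_indices ?s CARD('n). ?a e * C m e * (\<Prod>j<?s. t j ^ (e ! j)))"
    if "\<And>j. j < ?s \<Longrightarrow> 0 \<le> t j" for m t
    using C[of m] that unfolding mixed_volume_coeffs_def by simp
  have lim: "(\<lambda>m. vol (?X m t)) \<longlonglongrightarrow> vol (minkowski_comb Ls t)" for t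
    using Ls A by (rule vol_exhausts)
  have conv: "convergent (\<lambda>m. C m e)" if "e \<in> multi_indices ?s CARD('n)" for e
  proof -
    have "convergent (\<lambda>m. ?a e * C m e)"
    proof (rule multi_coeffs_convergent[where d = "\<lambda>m e. ?a e * C m e", OF _ that])
      fix t :: "nat \<Rightarrow> real" assume t: "\<And>j. j < ?s \<Longrightarrow> 0 \<le> t j"
      have "convergent (\<lambda>m. vol (?X m t))" using lim by (auto simp: convergent_def)
      then show "convergent (\<lambda>m. \<Sum>e\<in>multi_indices ?s CARD('n). ?a e * C m e * (\<Prod>j<?s. t j ^ (e ! j)))"
        by (simp only: eq[OF t])
    qed
    then show ?thesis by (subst (asm) convergent_mult_const_iff) auto
  qed
  then show "e \<in> multi_indices ?s CARD('n) \<Longrightarrow> convergent (\<lambda>m. C m e)" .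
  show "mixed_volume_coeffs Ls (\<lambda>e. lim (\<lambda>m. C m e))"
    unfolding mixed_volume_coeffs_def
  proof (intro allI impI)
    fix t :: "nat \<Rightarrow> real" assume "\<forall>j<?s. 0 \<le> t j"
    then have t: "0 \<le> t j" if "j < ?s" for j using that by blast
    have "(\<lambda>m. \<Sum>e\<in>multi_indices ?s CARD('n). ?a e * C m e * (\<Prod>j<?s. t j ^ (e ! j)))
      \<longlonglongrightarrow> (\<Sum>e\<in>multi_indices ?s CARD('n). ?a e * lim (\<lambda>m. C m e) * (\<Prod>j<?s. t j ^ (e ! j)))"
      by (intro tendsto_intros) (use conv convergent_LIMSEQ_iff in blast)
    then have "(\<lambda>m. vol (?X m t)) \<longlonglongrightarrow> (\<Sum>e\<in>multi_indices ?s CARD('n). ?a e * lim (\<lambda>m. C m e) * (\<Prod>j<?s. t j ^ (e ! j)))"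
      using eq[OF t] by simp
    then show "vol (minkowski_comb Ls t) = (\<Sum>e\<in>multi_indices ?s CARD('n). ?a e * lim (\<lambda>m. C m e) * (\<Prod>j<?s. t j ^ (e ! j)))"
      using lim LIMSEQ_unique by blast
  qed
qed

lemma polytopes_coeffs:
  fixes A :: "nat \<Rightarrow> (real ^ 'n::{finite,wellorder}) set"
  assumes "\<And>j. j < s \<Longrightarrow> finite (A j) \<and> A j \<noteq> {}"
  obtains c where "mixed_volume_coeffs (map (\<lambda>j. convex hull A j) [0..<s]) c" "\<And>e. 0 \<le> c e"
proof
  have "weight_on (\<lambda>_. 1) (A j)" if "j < s" for j
    using assms[OF that] by (auto simp: weight_on_def)
  from mixed_volume_coeffs_weighted_polytopes[of s "\<lambda>_ _. 1" A, OF this]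
  show "mixed_volume_coeffs (map (\<lambda>j. convex hull A j) [0..<s]) (disc_coeff s (\<lambda>_ _. 1) A)"
    by (simp add: weighted_polytopes_def weight_support_def)
qed (rule disc_coeff_nonneg)

lemma list_exhausts:
  assumes "\<And>L. L \<in> set Ls \<Longrightarrow> convex_body L"
  obtains A :: "nat \<Rightarrow> nat \<Rightarrow> 'a::euclidean_space set" where "\<And>j. j < length Ls \<Longrightarrow> exhausts (A j) (Ls ! j)"
proof -
  have "\<forall>j. \<exists>A. j < length Ls \<longrightarrow> exhausts A (Ls ! j)"
    using assms convex_body_exhausts by (metis nth_mem)
  then show thesis using that by metis
qed

lemma mixed_volume_coeffs_exist_wellorder:
  fixes Ls :: "(real ^ 'n::{finite,wellorder}) set list"
  assumes Ls: "\<And>L. L \<in> set Ls \<Longrightarrow> convex_body L"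
  obtains c where "mixed_volume_coeffs Ls c" "\<And>e. e \<in> multi_indices (length Ls) CARD('n) \<Longrightarrow> 0 \<le> c e"
proof -
  obtain A where A: "\<And>j. j < length Ls \<Longrightarrow> exhausts (A j) (Ls ! j)"
    using list_exhausts[of Ls] Ls by metis
  have "\<exists>c. mixed_volume_coeffs (map (\<lambda>j. convex hull A j m) [0..<length Ls]) c \<and> (\<forall>e. 0 \<le> c e)" for m
    by (rule polytopes_coeffs[of "length Ls" "\<lambda>j. A j m"]) (use A in \<open>auto simp: exhausts_def\<close>)
  then obtain C where C: "\<And>m. mixed_volume_coeffs (map (\<lambda>j. convex hull A j m) [0..<length Ls]) (C m)"
    and C0: "\<And>m e. 0 \<le> C m e" by metis
  show thesis
  proof (rule that)
    show "mixed_volume_coeffs Ls (\<lambda>e. lim (\<lambda>m. C m e))"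
      by (rule mixed_volume_coeffs_limit(1)[OF Ls A C])
    fix e assume "e \<in> multi_indices (length Ls) CARD('n)"
    from mixed_volume_coeffs_limit(2)[OF Ls A C this]
    have "(\<lambda>m. C m e) \<longlonglongrightarrow> lim (\<lambda>m. C m e)" by (simp add: convergent_LIMSEQ_iff)
    then show "0 \<le> lim (\<lambda>m. C m e)" by (rule LIMSEQ_le_const) (use C0 in blast)
  qed
qed

text \<open>The exhaustion of the larger bodies is enlarged by that of the smaller ones, so that the
  comparison for polytopes holds at each stage and survives in the limit.\<close>

lemma mixed_volume_coeffs_mono_wellorder:
  fixes Ks Ls :: "(real ^ 'n::{finite,wellorder}) set list"
  assumes Ks: "\<And>L. L \<in> set Ks \<Longrightarrow> convex_body L" and Ls: "\<And>L. L \<in> set Ls \<Longrightarrow> convex_body L"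
    and sub: "list_all2 (\<subseteq>) Ks Ls"
    and c: "mixed_volume_coeffs Ks c" and d: "mixed_volume_coeffs Ls d"
    and e: "e \<in> multi_indices (length Ks) CARD('n)"
  shows "c e \<le> d e"
proof -
  define s where "s = length Ks"
  have len: "length Ls = s" "length Ks = s" using sub by (auto simp: list_all2_lengthD s_def)
  have sub': "Ks ! j \<subseteq> Ls ! j" if "j < s" for j
    using sub that by (auto simp: list_all2_conv_all_nth s_def)
  obtain B where B: "\<And>j. j < s \<Longrightarrow> exhausts (B j) (Ks ! j)"
    using list_exhausts[of Ks] Ks len by metis
  obtain A' where A': "\<And>j. j < s \<Longrightarrow> exhausts (A' j) (Ls ! j)"
    using list_exhausts[of Ls] Ls len by metis
  define A where "A j m = A' j m \<union> B j m" for j m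
  have A: "exhausts (A j) (Ls ! j)" if "j < s" for j
    unfolding A_def by (rule exhausts_Un) (use A' B sub' that in auto)
  have "\<exists>c. mixed_volume_coeffs (map (\<lambda>j. convex hull A j m) [0..<s]) c" for m
    by (rule polytopes_coeffs[of s "\<lambda>j. A j m"]) (use A in \<open>auto simp: exhausts_def\<close>)
  then obtain D where D: "\<And>m. mixed_volume_coeffs (map (\<lambda>j. convex hull A j m) [0..<s]) (D m)"
    by metis
  have "\<exists>c. mixed_volume_coeffs (map (\<lambda>j. convex hull B j m) [0..<s]) c" for m
    by (rule polytopes_coeffs[of s "\<lambda>j. B j m"]) (use B in \<open>auto simp: exhausts_def\<close>)
  then obtain C where C: "\<And>m. mixed_volume_coeffs (map (\<lambda>j. convex hull B j m) [0..<s]) (C m)"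
    by metis
  have CD: "C m e \<le> D m e" for m
  proof (rule mixed_volume_coeffs_polytopes_mono[OF _ D C])
    show "finite (A j m) \<and> B j m \<noteq> {} \<and> B j m \<subseteq> A j m" if "j < s" for j
      using A[OF that] B[OF that] by (auto simp: exhausts_def A_def)
  qed (use e len in auto)
  have cC: "c e = lim (\<lambda>m. C m e)" "(\<lambda>m. C m e) \<longlonglongrightarrow> lim (\<lambda>m. C m e)"
    using mixed_volume_coeffs_unique[OF c _ e] mixed_volume_coeffs_limit[of Ks B C, OF Ks] B C e len
    by (auto simp: convergent_LIMSEQ_iff)
  have dD: "d e = lim (\<lambda>m. D m e)" "(\<lambda>m. D m e) \<longlonglongrightarrow> lim (\<lambda>m. D m e)"
    using mixed_volume_coeffs_unique[OF d _, of _ e] mixed_volume_coeffs_limit[of Ls A D, OF Ls] A D e len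
    by (auto simp: convergent_LIMSEQ_iff)
  show ?thesis
    unfolding cC(1) dD(1) using LIMSEQ_le[OF cC(2) dD(2)] CD by blast
qed

section \<open>Transfer to arbitrary finite index types\<close>

text \<open>The change of variables theorem of the library needs a well-ordered index type. A copy of an
  arbitrary finite type, ordered by an injection into the naturals, provides one.\<close>

typedef 'a ordered_copy = "UNIV :: 'a set"
  morphisms of_copy to_copy by auto

instance ordered_copy :: (finite) finite
proof
  have "(UNIV :: 'a ordered_copy set) = range to_copy"
    by (metis of_copy_inverse surj_def)
  then show "finite (UNIV :: 'a ordered_copy set)" by (metis finite finite_imageI)
qed

definition copy_rank :: "'a::finite ordered_copy \<Rightarrow> nat" where
  "copy_rank = (SOME f. inj f)"

lemma inj_copy_rank: "inj (copy_rank :: 'a::finite ordered_copy \<Rightarrow> nat)"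
proof -
  have "\<exists>f :: 'a ordered_copy \<Rightarrow> nat. inj f"
    using finite_imp_inj_to_nat_seg[of "UNIV :: 'a ordered_copy set"] by auto
  then show ?thesis unfolding copy_rank_def by (rule someI_ex)
qed

instantiation ordered_copy :: (finite) wellorder
begin

definition "x \<le> y \<longleftrightarrow> copy_rank x \<le> copy_rank y"
definition "x < y \<longleftrightarrow> copy_rank x < copy_rank y"

instance
proof
  fix x y z :: "'a ordered_copy" and P
  show "x = y" if "x \<le> y" "y \<le> x"
    using that inj_copy_rank by (auto simp: less_eq_ordered_copy_def dest: injD)
  show "P x" if "\<And>x. (\<And>y. y < x \<Longrightarrow> P y) \<Longrightarrow> P x"
  proof (induction x rule: measure_induct_rule[of copy_rank])
    case (less x)
    show ?case by (rule that) (rule less, simp only: less_ordered_copy_def)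
  qed
qed (auto simp: less_eq_ordered_copy_def less_ordered_copy_def)

end

lemma bij_of_copy: "bij of_copy"
  by (intro bijI injI surjI[of _ to_copy]) (simp_all add: of_copy_inject to_copy_inverse)

lemma CARD_ordered_copy: "CARD('a ordered_copy) = CARD('a)"
  using bij_betw_same_card[OF bij_of_copy] .

section \<open>Relabelling coordinates by the ordered copy\<close>

definition copy_vec :: "real ^ 'n \<Rightarrow> real ^ ('n ordered_copy)" where
  "copy_vec x = (\<chi> i. x $ of_copy i)"

definition uncopy_vec :: "real ^ ('n ordered_copy) \<Rightarrow> real ^ 'n" where
  "uncopy_vec x = (\<chi> i. x $ to_copy i)"

lemma copy_vec_inverse [simp]: "uncopy_vec (copy_vec x) = x" "copy_vec (uncopy_vec y) = y"
  by (simp_all add: uncopy_vec_def copy_vec_def vec_eq_iff to_copy_inverse of_copy_inverse)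

lemma inj_copy_vec: "inj copy_vec"
  by (metis copy_vec_inverse(1) injI)

lemma linear_copy_vec: "linear copy_vec"
  by (rule linearI) (simp_all add: copy_vec_def vec_eq_iff)

lemma prod_Basis_cart: "(\<Prod>b\<in>Basis. (v :: real ^ 'm) \<bullet> b) = (\<Prod>i\<in>UNIV. v $ i)"
proof -
  have B: "(Basis :: (real ^ 'm) set) = range (\<lambda>i. axis i 1)" by (auto simp: Basis_vec_def)
  have inj: "inj (\<lambda>i :: 'm. axis i (1::real))" by (auto simp: inj_def axis_eq_axis)
  show ?thesis
    unfolding B prod.reindex[OF inj] by (simp add: comp_def inner_axis)
qed

text \<open>The preimage of a box is a box with the same side lengths, and \<open>lborel\<close> is
  determined by its values on boxes.\<close>

lemma distr_copy_vec: "distr lborel borel (copy_vec :: real ^ 'n \<Rightarrow> _) = lborel"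
proof (rule lborel_eqI[symmetric])
  have meas: "copy_vec \<in> lborel \<rightarrow>\<^sub>M (borel :: (real ^ ('n ordered_copy)) measure)"
    using linear_continuous_on[of copy_vec UNIV] linear_copy_vec
    by (auto intro!: borel_measurable_continuous_onI simp: linear_conv_bounded_linear)
  fix l u :: "real ^ ('n ordered_copy)"
  assume le: "\<And>b. b \<in> Basis \<Longrightarrow> l \<bullet> b \<le> u \<bullet> b"
  then have le': "l $ i \<le> u $ i" for i
    by (metis axis_in_Basis_iff cart_eq_inner_axis inner_commute one_neq_zero Basis_real_def singletonI)
  have pre: "copy_vec -` box l u = box (uncopy_vec l) (uncopy_vec u)"
  proof (intro set_eqI iffI)
    fix x assume "x \<in> copy_vec -` box l u"
    then have "l $ to_copy i < copy_vec x $ to_copy i \<and> copy_vec x $ to_copy i < u $ to_copy i" for i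
      by (simp add: mem_box_cart)
    then show "x \<in> box (uncopy_vec l) (uncopy_vec u)"
      by (simp add: mem_box_cart copy_vec_def uncopy_vec_def to_copy_inverse)
  next
    fix x assume "x \<in> box (uncopy_vec l) (uncopy_vec u)"
    then have "uncopy_vec l $ of_copy i < x $ of_copy i \<and> x $ of_copy i < uncopy_vec u $ of_copy i" for i
      by (simp add: mem_box_cart)
    then show "x \<in> copy_vec -` box l u"
      by (simp add: mem_box_cart copy_vec_def uncopy_vec_def of_copy_inverse)
  qed
  have "emeasure (distr lborel borel copy_vec) (box l u) = emeasure lborel (box (uncopy_vec l) (uncopy_vec u))"
    using meas by (simp add: emeasure_distr pre)
  also have "\<dots> = ennreal (\<Prod>b\<in>Basis. (uncopy_vec u - uncopy_vec l) \<bullet> b)"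
  proof (rule emeasure_lborel_box)
    fix b :: "real ^ 'n" assume "b \<in> Basis"
    then show "uncopy_vec l \<bullet> b \<le> uncopy_vec u \<bullet> b"
      using le' by (auto simp: Basis_vec_def inner_axis uncopy_vec_def)
  qed
  also have "(\<Prod>b\<in>Basis. (uncopy_vec u - uncopy_vec l) \<bullet> b) = (\<Prod>i\<in>UNIV. (u - l) $ to_copy i)"
    unfolding prod_Basis_cart by (simp add: uncopy_vec_def)
  also have "\<dots> = (\<Prod>i\<in>UNIV. (u - l) $ i)"
    by (rule prod.reindex_bij_witness[of _ of_copy to_copy]) (auto simp: of_copy_inverse to_copy_inverse)
  finally show "emeasure (distr lborel borel copy_vec) (box l u) = ennreal (\<Prod>b\<in>Basis. (u - l) \<bullet> b)"
    unfolding prod_Basis_cart .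
qed simp

lemma compact_copy_vec: "compact S \<Longrightarrow> compact (copy_vec ` S)"
  using linear_copy_vec
  by (intro compact_continuous_image linear_continuous_on) (simp_all add: linear_conv_bounded_linear)

text \<open>Compactness of \<open>S\<close> makes \<open>S\<close> and its image Borel sets, on
  which \<open>lebesgue\<close> and \<open>lborel\<close> agree.\<close>

lemma vol_copy_vec:
  assumes "compact S"
  shows "vol (copy_vec ` S) = vol S"
proof -
  have meas: "(copy_vec :: real ^ 'a \<Rightarrow> _) \<in> lborel \<rightarrow>\<^sub>M borel"
    using linear_continuous_on[of copy_vec UNIV] linear_copy_vec
    by (auto intro!: borel_measurable_continuous_onI simp: linear_conv_bounded_linear)
  have S: "S \<in> sets borel" "copy_vec ` S \<in> sets borel"
    using assms compact_copy_vec borel_compact by auto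
  have "vol (copy_vec ` S) = measure (distr lborel borel copy_vec) (copy_vec ` S)"
    using S by (simp add: distr_copy_vec)
  also have "\<dots> = measure lborel S"
    using meas S by (simp add: measure_distr inj_vimage_image_eq[OF inj_copy_vec])
  finally show ?thesis using S by simp
qed

lemma convex_body_copy_vec: "convex_body L \<Longrightarrow> convex_body (copy_vec ` L)"
  unfolding convex_body_def using compact_copy_vec convex_linear_image[OF linear_copy_vec] by blast

lemma minkowski_comb_copy_vec:
  "minkowski_comb (map ((`) copy_vec) Ls) t = copy_vec ` minkowski_comb Ls t"
proof -
  have lin: "copy_vec (\<Sum>j<length Ls. t j *\<^sub>R y j) = (\<Sum>j<length Ls. t j *\<^sub>R copy_vec (y j))" for y
    by (simp add: linear_sum[OF linear_copy_vec] linear_cmul[OF linear_copy_vec])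
  show ?thesis
    unfolding minkowski_comb_eq
  proof (intro equalityI subsetI)
    fix z assume "z \<in> {\<Sum>j<length (map ((`) copy_vec) Ls). t j *\<^sub>R y j |y.
        \<forall>j<length (map ((`) copy_vec) Ls). y j \<in> map ((`) copy_vec) Ls ! j}"
    then obtain y where z: "z = (\<Sum>j<length Ls. t j *\<^sub>R y j)" and y: "\<And>j. j < length Ls \<Longrightarrow> y j \<in> copy_vec ` (Ls ! j)"
      by auto
    have "z = copy_vec (\<Sum>j<length Ls. t j *\<^sub>R uncopy_vec (y j))" by (simp add: lin z)
    moreover have "uncopy_vec (y j) \<in> Ls ! j" if "j < length Ls" for j using y[OF that] by auto
    ultimately show "z \<in> copy_vec ` {\<Sum>j<length Ls. t j *\<^sub>R y j |y. \<forall>j<length Ls. y j \<in> Ls ! j}"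
      by (intro image_eqI CollectI exI[of _ "\<lambda>j. uncopy_vec (y j)"]) simp_all
  next
    fix z assume "z \<in> copy_vec ` {\<Sum>j<length Ls. t j *\<^sub>R y j |y. \<forall>j<length Ls. y j \<in> Ls ! j}"
    then obtain y where z: "z = copy_vec (\<Sum>j<length Ls. t j *\<^sub>R y j)" and y: "\<And>j. j < length Ls \<Longrightarrow> y j \<in> Ls ! j"
      by auto
    then show "z \<in> {\<Sum>j<length (map ((`) copy_vec) Ls). t j *\<^sub>R y j |y.
        \<forall>j<length (map ((`) copy_vec) Ls). y j \<in> map ((`) copy_vec) Ls ! j}"
      by (intro CollectI exI[of _ "\<lambda>j. copy_vec (y j)"]) (simp add: lin)
  qed
qed

text \<open>Exponents are lists over the bodies and do not mention the coordinates, so the same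
  \<open>c\<close> serves both index types.\<close>

lemma mixed_volume_coeffs_copy_vec:
  assumes "\<forall>L\<in>set Ls. convex_body L"
  shows "mixed_volume_coeffs (map ((`) copy_vec) Ls) c \<longleftrightarrow> mixed_volume_coeffs Ls c"
proof -
  have "compact (minkowski_comb Ls t)" for t
    by (intro compact_minkowski_comb) (use assms in \<open>auto simp: convex_body_def\<close>)
  then show ?thesis
    unfolding mixed_volume_coeffs_def
    by (simp add: minkowski_comb_copy_vec vol_copy_vec CARD_ordered_copy)
qed

section \<open>Existence, nonnegativity and monotonicity of mixed volumes\<close>

theorem mixed_volume_coeffs_exist:
  fixes Ls :: "(real ^ 'n) set list"
  assumes "\<forall>L\<in>set Ls. convex_body L"
  shows "\<exists>c. mixed_volume_coeffs Ls c \<and> (\<forall>e\<in>multi_indices (length Ls) CARD('n). 0 \<le> c e)"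
proof -
  obtain c where "mixed_volume_coeffs (map ((`) copy_vec) Ls) c"
    "\<And>e. e \<in> multi_indices (length (map ((`) copy_vec) Ls)) CARD('n ordered_copy) \<Longrightarrow> 0 \<le> c e"
    by (rule mixed_volume_coeffs_exist_wellorder[of "map ((`) copy_vec) Ls"])
      (use assms convex_body_copy_vec in auto)
  then show ?thesis
    using mixed_volume_coeffs_copy_vec[OF assms] by (intro exI[of _ c]) (simp add: CARD_ordered_copy)
qed

lemma mixed_volume_coeffs_mixed_volume:
  fixes Ls :: "(real ^ 'n) set list"
  assumes Ls: "\<forall>L\<in>set Ls. convex_body L"
  shows "mixed_volume_coeffs Ls (mixed_volume Ls)"
proof -
  obtain c where c: "mixed_volume_coeffs Ls c"
    using mixed_volume_coeffs_exist[OF Ls] by blast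
  have eq: "mixed_volume Ls e = c e" if "e \<in> multi_indices (length Ls) CARD('n)" for e
    using c that by (rule mixed_volume_eqI)
  show ?thesis using c unfolding mixed_volume_coeffs_def by (simp add: eq)
qed

lemma mixed_volume_nonneg:
  fixes Ls :: "(real ^ 'n) set list"
  assumes Ls: "\<forall>L\<in>set Ls. convex_body L" and e: "e \<in> multi_indices (length Ls) CARD('n)"
  shows "0 \<le> mixed_volume Ls e"
proof -
  obtain c where c: "mixed_volume_coeffs Ls c" "0 \<le> c e"
    using mixed_volume_coeffs_exist[OF Ls] e by blast
  then show ?thesis using mixed_volume_eqI[OF c(1) e] by simp
qed

theorem mixed_volume_mono:
  fixes Ks Ls :: "(real ^ 'n) set list"
  assumes Ks: "\<forall>L\<in>set Ks. convex_body L" and Ls: "\<forall>L\<in>set Ls. convex_body L"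
    and sub: "list_all2 (\<subseteq>) Ks Ls" and e: "e \<in> multi_indices (length Ks) CARD('n)"
  shows "mixed_volume Ks e \<le> mixed_volume Ls e"
proof (rule mixed_volume_coeffs_mono_wellorder[of "map ((`) copy_vec) Ks" "map ((`) copy_vec) Ls"])
  show "list_all2 (\<subseteq>) (map ((`) copy_vec) Ks) (map ((`) copy_vec) Ls)"
    using sub by (auto simp: list_all2_conv_all_nth intro!: image_mono)
  show "mixed_volume_coeffs (map ((`) copy_vec) Ks) (mixed_volume Ks)"
    using mixed_volume_coeffs_mixed_volume[OF Ks] mixed_volume_coeffs_copy_vec[OF Ks] by simp
  show "mixed_volume_coeffs (map ((`) copy_vec) Ls) (mixed_volume Ls)"
    using mixed_volume_coeffs_mixed_volume[OF Ls] mixed_volume_coeffs_copy_vec[OF Ls] by simp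
qed (use Ks Ls e convex_body_copy_vec in \<open>auto simp: CARD_ordered_copy\<close>)

section \<open>Relative inradius and volume\<close>

text \<open>On each facet with outer normal \<open>u\<close> stands a prism of height \<open>\<tau>/N\<close> in the direction of a point
  of \<open>K\<close> extremal for \<open>u\<close>. These prisms lie outside \<open>P\<close> and overlap only in hyperplanes, and
  \<open>P\<close> is covered by \<open>N\<close> inward translates of each of them, since \<open>\<tau>K\<close> does not fit in \<open>P\<close>.\<close>

lemma measure_polytope_plus_ge:
  fixes K :: "'a::euclidean_space set" and U :: "'a set"
  defines "P \<equiv> {x. \<forall>u\<in>U. u \<bullet> x \<le> 1}"
  assumes finU: "finite U" and P: "compact P"
    and K: "compact K" "convex K" "0 \<in> K"
    and \<tau>: "0 < \<tau>" and nofit: "\<And>x. \<not> (\<lambda>k. x + \<tau> *\<^sub>R k) ` K \<subseteq> P" and N: "0 < (N :: nat)"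
  shows "(1 + 1 / N) * measure lebesgue P \<le> measure lebesgue (P + (\<lambda>k. (\<tau> / N) *\<^sub>R k) ` K)"
proof -
  define \<epsilon> where "\<epsilon> = \<tau> / N"
  have \<epsilon>: "0 < \<epsilon>" "\<tau> = N * \<epsilon>" using \<tau> N by (auto simp: \<epsilon>_def)
  \<comment> \<open>\<open>k u\<close> is a point of \<open>K\<close> extremal in the direction
    \<open>u\<close>, and \<open>h\<close> will be the support function of \<open>K\<close>.\<close>
  have "\<exists>k\<in>K. \<forall>k'\<in>K. u \<bullet> k' \<le> u \<bullet> k" for u
    using K by (intro continuous_attains_sup) (auto intro!: continuous_intros)
  then obtain k where k: "\<And>u. k u \<in> K" "\<And>u k'. k' \<in> K \<Longrightarrow> u \<bullet> k' \<le> u \<bullet> k u" by metis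
  define h where "h u = u \<bullet> k u" for u
  have h: "0 \<le> h u" for u using k(2)[OF K(3), of u] by (simp add: h_def)
  \<comment> \<open>As \<open>K\<close> contains the origin, \<open>h\<close> is nonnegative.
    Constraints with \<open>h u = 0\<close> are not violated by adding multiples of points of
    \<open>K\<close>, so only those in \<open>V\<close> can keep a copy of \<open>K\<close> from
    fitting.\<close>
  define V where "V = {u \<in> U. 0 < h u}"
  have finV: "finite V" using finU by (simp add: V_def)
  have fits: "(\<lambda>k. x + \<tau> *\<^sub>R k) ` K \<subseteq> P" if x: "x \<in> P" and *: "\<And>u. u \<in> V \<Longrightarrow> u \<bullet> x + \<tau> * h u \<le> 1" for x
  proof
    fix z assume "z \<in> (\<lambda>k. x + \<tau> *\<^sub>R k) ` K"
    then obtain k' where k': "k' \<in> K" "z = x + \<tau> *\<^sub>R k'" by blast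
    have "u \<bullet> z \<le> 1" if u: "u \<in> U" for u
    proof -
      have "u \<bullet> z \<le> u \<bullet> x + \<tau> * h u"
        using k(2)[OF k'(1), of u] \<tau> by (simp add: k' inner_add_right h_def)
      also have "\<dots> \<le> 1"
      proof (cases "u \<in> V")
        case False
        then have "h u = 0" using h[of u] u by (auto simp: V_def)
        then show ?thesis using x u by (simp add: P_def)
      qed (rule *)
      finally show ?thesis .
    qed
    then show "z \<in> P" by (simp add: P_def)
  qed
  have "0 \<in> P" by (simp add: P_def)
  have neV: "V \<noteq> {}" using fits[OF \<open>0 \<in> P\<close>] nofit by blast
  define F where "F u = {x \<in> P. u \<bullet> x = 1}" for u
  define B where "B u = (\<lambda>(y, t). y + t *\<^sub>R k u) ` (F u \<times> {0..\<epsilon>})" for u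
  define S where "S = P + (\<lambda>k. \<epsilon> *\<^sub>R k) ` K"
  have compF: "compact (F u)" for u
  proof -
    have "F u = P \<inter> {x. u \<bullet> x = 1}" by (auto simp: F_def)
    then show ?thesis using compact_Int_closed[OF P closed_hyperplane[of u 1]] by simp
  qed
  have compB: "compact (B u)" for u
    unfolding B_def
    by (intro compact_continuous_image compact_Times compF) (auto intro!: continuous_intros simp: split_beta)
  have BmS: "B u \<in> lmeasurable" for u using compB by (rule lmeasurable_compact)
  have Pm: "P \<in> lmeasurable" using P by (rule lmeasurable_compact)
  have compS: "compact S"
    unfolding S_def using P K by (intro compact_set_plus compact_scaling)
  have BS: "B u \<subseteq> S" for u
  proof
    fix z assume "z \<in> B u"
    then obtain y t where y: "y \<in> F u" and t: "0 \<le> t" "t \<le> \<epsilon>" and z: "z = y + t *\<^sub>R k u"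
      by (auto simp: B_def)
    have "(1 - t / \<epsilon>) *\<^sub>R 0 + (t / \<epsilon>) *\<^sub>R k u \<in> K"
      using K k(1)[of u] t \<epsilon> by (intro convexD_alt) auto
    then have "\<epsilon> *\<^sub>R (t / \<epsilon>) *\<^sub>R k u \<in> (\<lambda>k. \<epsilon> *\<^sub>R k) ` K"
      by (intro imageI) simp
    then have "t *\<^sub>R k u \<in> (\<lambda>k. \<epsilon> *\<^sub>R k) ` K" using \<epsilon> by simp
    moreover have "y \<in> P" using y by (simp add: F_def)
    ultimately show "z \<in> S" unfolding z S_def by (rule set_plus_intro[rotated])
  qed
  have PS: "P \<subseteq> S"
  proof
    fix x assume "x \<in> P"
    moreover have "0 \<in> (\<lambda>k. \<epsilon> *\<^sub>R k) ` K" using K(3) by force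
    ultimately have "x + 0 \<in> S" unfolding S_def by (rule set_plus_intro)
    then show "x \<in> S" by simp
  qed
  have PB: "negligible (P \<inter> B u)" if u: "u \<in> V" for u
  proof (rule negligible_subset)
    show "negligible {x. u \<bullet> x = 1}" by (rule negligible_hyperplane) simp
    show "P \<inter> B u \<subseteq> {x. u \<bullet> x = 1}"
    proof safe
      fix z assume z: "z \<in> P" "z \<in> B u"
      then obtain y t where y: "y \<in> F u" and t: "0 \<le> t" and zz: "z = y + t *\<^sub>R k u"
        by (auto simp: B_def)
      have "u \<bullet> z = 1 + t * h u" using y by (simp add: zz inner_add_right F_def h_def)
      moreover have "u \<bullet> z \<le> 1" using z u by (auto simp: P_def V_def)
      moreover have "0 \<le> t * h u" using t h by simp
      ultimately show "u \<bullet> z = 1" by linarith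
    qed
  qed
  have BB: "negligible (B u \<inter> B v)" if uv: "u \<in> V" "v \<in> V" "u \<noteq> v" for u v
  proof (rule negligible_subset)
    have pos: "0 < h u" "0 < h v" using uv by (auto simp: V_def)
    \<comment> \<open>A common point of both prisms has the same height over both facets. The height
      over the facet of \<open>u\<close> is \<open>(u \<bullet> x - 1) / h u\<close>, and equating
      the two expressions gives this hyperplane. It could degenerate only if
      \<open>u = v\<close>.\<close>
    show "negligible {x. (u /\<^sub>R h u - v /\<^sub>R h v) \<bullet> x = 1 / h u - 1 / h v}"
    proof (rule negligible_hyperplane, rule ccontr)
      assume "\<not> (u /\<^sub>R h u - v /\<^sub>R h v \<noteq> 0 \<or> 1 / h u - 1 / h v \<noteq> 0)"
      then have "u /\<^sub>R h u = v /\<^sub>R h v" "h u = h v" using pos by (auto simp: field_simps)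
      then show False using uv pos by simp
    qed
    \<comment> \<open>Evaluating \<open>a\<close> at the common point gives exactly
      \<open>1 + t * h a\<close> from the first representation and at most
      \<open>1 + t' * h a\<close> from the second, since \<open>k a\<close> is extremal for
      \<open>a\<close>. By symmetry the heights agree.\<close>
    have le: "t \<le> t'" if "y \<in> F a" "y' \<in> F b" "y + t *\<^sub>R k a = y' + t' *\<^sub>R k b" "0 \<le> t'" "a \<in> V" for a b y y' t t'
    proof -
      have "1 + t * h a = a \<bullet> (y + t *\<^sub>R k a)" using that(1) by (simp add: inner_add_right F_def h_def)
      also have "\<dots> = a \<bullet> y' + t' * (a \<bullet> k b)" using that(3) by (simp add: inner_add_right)
      also have "\<dots> \<le> 1 + t' * h a"
        using that k by (intro add_mono mult_left_mono) (auto simp: F_def P_def V_def h_def)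
      finally show ?thesis using that(5) by (simp add: V_def)
    qed
    show "B u \<inter> B v \<subseteq> {x. (u /\<^sub>R h u - v /\<^sub>R h v) \<bullet> x = 1 / h u - 1 / h v}"
    proof
      fix z assume "z \<in> B u \<inter> B v"
      then obtain y t y' t' where y: "y \<in> F u" "0 \<le> t" "z = y + t *\<^sub>R k u"
        and y': "y' \<in> F v" "0 \<le> t'" "z = y' + t' *\<^sub>R k v"
        by (auto simp: B_def)
      have "t = t'" using le[OF y(1) y'(1), of t t'] le[OF y'(1) y(1), of t' t] y y' uv by auto
      moreover have "u \<bullet> z = 1 + t * h u" using y by (simp add: inner_add_right F_def h_def)
      moreover have "v \<bullet> z = 1 + t' * h v" using y' by (simp add: inner_add_right F_def h_def)
      ultimately show "z \<in> {x. (u /\<^sub>R h u - v /\<^sub>R h v) \<bullet> x = 1 / h u - 1 / h v}"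
        using pos by (simp add: inner_diff_left field_simps)
    qed
  qed
  have cover: "P \<subseteq> (\<Union>u\<in>V. \<Union>m<N. (+) (- (real (Suc m) * \<epsilon>) *\<^sub>R k u) ` B u)"
  proof
    fix x assume x: "x \<in> P"
    \<comment> \<open>The largest \<open>s\<close> for which \<open>x + s K\<close> stays in
      \<open>P\<close>; it is below \<open>\<tau>\<close> by assumption. A minimising
      \<open>u\<close> is a constraint that stops the growth, so \<open>x + s *\<^sub>R k u\<close>
      lies on its facet.\<close>
    define s where "s = Min ((\<lambda>u. (1 - u \<bullet> x) / h u) ` V)"
    have "s \<in> (\<lambda>u. (1 - u \<bullet> x) / h u) ` V" unfolding s_def using finV neV by (intro Min_in) auto
    then obtain u where u: "u \<in> V" "s = (1 - u \<bullet> x) / h u" by blast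
    have pos: "0 < h v" if "v \<in> V" for v using that by (simp add: V_def)
    have smin: "v \<bullet> x + s * h v \<le> 1" if v: "v \<in> V" for v
    proof -
      have "s \<le> (1 - v \<bullet> x) / h v" unfolding s_def using finV v by (intro Min_le) auto
      then show ?thesis using pos[OF v] by (simp add: field_simps)
    qed
    have s0: "0 \<le> s" using x u pos[OF u(1)] by (auto simp: P_def V_def)
    have "s < \<tau>"
    proof (rule ccontr)
      assume "\<not> s < \<tau>"
      then have "v \<bullet> x + \<tau> * h v \<le> 1" if "v \<in> V" for v
        using smin[OF that] mult_right_mono[of \<tau> s "h v"] h[of v] by linarith
      then show False using fits[OF x] nofit by blast
    qed
    \<comment> \<open>Rounding \<open>s\<close> up to the multiple \<open>Suc m * \<epsilon>\<close>
      leaves a remainder between zero and \<open>\<epsilon>\<close>, the height of a point in the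
      prism. Shifting back by this multiple returns to \<open>x\<close>, and
      \<open>s < N * \<epsilon>\<close> bounds the number of shifts.\<close>
    define m where "m = nat \<lfloor>s / \<epsilon>\<rfloor>"
    have m: "real m * \<epsilon> \<le> s" "s \<le> real (Suc m) * \<epsilon>"
    proof -
      have "real m \<le> s / \<epsilon>" "s / \<epsilon> \<le> real (Suc m)"
        using s0 \<epsilon> by (auto simp: m_def) linarith+
      then show "real m * \<epsilon> \<le> s" "s \<le> real (Suc m) * \<epsilon>" using \<epsilon>(1) by (simp_all add: field_simps)
    qed
    have "real m * \<epsilon> < real N * \<epsilon>" using m(1) \<open>s < \<tau>\<close> \<epsilon>(2) by linarith
    then have mN: "m < N" using \<epsilon>(1) by simp
    define y where "y = x + s *\<^sub>R k u"
    have "y \<in> F u"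
    proof -
      have "v \<bullet> y \<le> 1" if v: "v \<in> U" for v
      proof -
        have "v \<bullet> y \<le> v \<bullet> x + s * h v"
          using k(2)[OF k(1), of v u] s0 by (simp add: y_def inner_add_right h_def mult_left_mono)
        also have "\<dots> \<le> 1"
        proof (cases "v \<in> V")
          case False
          then have "h v = 0" using h[of v] v by (auto simp: V_def)
          then show ?thesis using x v by (simp add: P_def)
        qed (rule smin)
        finally show ?thesis .
      qed
      moreover have "u \<bullet> y = 1" using u pos[OF u(1)] by (simp add: y_def inner_add_right h_def)
      ultimately show ?thesis by (simp add: F_def P_def)
    qed
    then have "y + (real (Suc m) * \<epsilon> - s) *\<^sub>R k u \<in> B u"
      unfolding B_def using m
      by (intro image_eqI[of _ _ "(y, real (Suc m) * \<epsilon> - s)"]) (auto simp: algebra_simps)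
    moreover have "x = - (real (Suc m) * \<epsilon>) *\<^sub>R k u + (y + (real (Suc m) * \<epsilon> - s) *\<^sub>R k u)"
      by (simp add: y_def algebra_simps)
    ultimately show "x \<in> (\<Union>u\<in>V. \<Union>m<N. (+) (- (real (Suc m) * \<epsilon>) *\<^sub>R k u) ` B u)"
      using u(1) mN by blast
  qed
  have shift: "(+) a ` B u \<in> lmeasurable" for a u
    using compact_translation[OF compB] by (rule lmeasurable_compact)
  have "measure lebesgue P \<le> measure lebesgue (\<Union>u\<in>V. \<Union>m<N. (+) (- (real (Suc m) * \<epsilon>) *\<^sub>R k u) ` B u)"
    using cover Pm by (intro measure_mono_fmeasurable fmeasurable.finite_UN finV shift fmeasurableD) auto
  also have "\<dots> \<le> (\<Sum>u\<in>V. measure lebesgue (\<Union>m<N. (+) (- (real (Suc m) * \<epsilon>) *\<^sub>R k u) ` B u))"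
    by (intro measure_UNION_le finV fmeasurableD fmeasurable.finite_UN shift) auto
  also have "\<dots> \<le> (\<Sum>u\<in>V. \<Sum>m<N. measure lebesgue ((+) (- (real (Suc m) * \<epsilon>) *\<^sub>R k u) ` B u))"
    by (intro sum_mono measure_UNION_le fmeasurableD shift) auto
  also have "\<dots> = N * (\<Sum>u\<in>V. measure lebesgue (B u))"
    by (simp only: measure_translation sum_constant card_lessThan sum_distrib_left)
  \<comment> \<open>Each prism was used in \<open>N\<close> translates of equal volume, so the
    prisms themselves fill at least a fraction \<open>1/N\<close> of the volume of
    \<open>P\<close>.\<close>
  finally have 1: "measure lebesgue P / N \<le> (\<Sum>u\<in>V. measure lebesgue (B u))"
    using N by (simp add: field_simps)
  have UBm: "(\<Union>u\<in>V. B u) \<in> lmeasurable" by (intro fmeasurable.finite_UN finV BmS)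
  have "measure lebesgue (\<Union>u\<in>V. B u) = (\<Sum>u\<in>V. measure lebesgue (B u))"
    by (intro measure_negligible_finite_Union_image finV BmS) (auto simp: pairwise_def BB)
  moreover have "measure lebesgue (P \<inter> (\<Union>u\<in>V. B u)) = 0"
  proof (rule negligible_imp_measure0)
    have eq: "P \<inter> (\<Union>u\<in>V. B u) = \<Union> ((\<lambda>u. P \<inter> B u) ` V)" by blast
    show "negligible (P \<inter> (\<Union>u\<in>V. B u))"
      unfolding eq using finV PB by (intro negligible_Union) auto
  qed
  ultimately have "measure lebesgue (P \<union> (\<Union>u\<in>V. B u)) = measure lebesgue P + (\<Sum>u\<in>V. measure lebesgue (B u))"
    using measure_Un3[OF Pm UBm] by simp
  moreover have "measure lebesgue (P \<union> (\<Union>u\<in>V. B u)) \<le> measure lebesgue S"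
    using PS BS by (intro measure_mono_fmeasurable fmeasurableD fmeasurable.Un Pm UBm lmeasurable_compact compS) auto
  ultimately show ?thesis using 1 by (simp add: S_def \<epsilon>_def distrib_right)
qed

text \<open>Each frontier point of the enlarged body \<open>E\<close> is cut off by a halfspace
  containing \<open>D\<close>, and by compactness finitely many halfspaces suffice. Their
  intersection is connected, contains the origin and misses the frontier of \<open>E\<close>, so it
  cannot leave \<open>E\<close>.\<close>

lemma polytope_between:
  fixes D :: "'a::euclidean_space set"
  assumes D: "compact D" "convex D" and 0: "0 \<in> interior D" and \<delta>: "0 < \<delta>"
  obtains U where "finite U" "D \<subseteq> {x. \<forall>u\<in>U. u \<bullet> x \<le> 1}"
    "{x. \<forall>u\<in>U. u \<bullet> x \<le> 1} \<subseteq> (\<lambda>x. (1 + \<delta>) *\<^sub>R x) ` D"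
proof -
  define E where "E = (\<lambda>x. (1 + \<delta>) *\<^sub>R x) ` D"
  have compE: "compact E" unfolding E_def using D(1) by (rule compact_scaling)
  have intE: "D \<subseteq> interior E"
  proof
    fix x assume x: "x \<in> D"
    have "x - (\<delta> / (1 + \<delta>)) *\<^sub>R (x - 0) \<in> interior D"
      using D 0 x \<delta> by (intro mem_interior_convex_shrink) auto
    then have "(1 + \<delta>) *\<^sub>R (x - (\<delta> / (1 + \<delta>)) *\<^sub>R x) \<in> (\<lambda>x. (1 + \<delta>) *\<^sub>R x) ` interior D"
      by (intro imageI) simp
    moreover have "(1 + \<delta>) *\<^sub>R (x - (\<delta> / (1 + \<delta>)) *\<^sub>R x) = x"
      using \<delta> by (simp add: scaleR_diff_right scaleR_left_distrib)
    ultimately have "x \<in> (\<lambda>x. (1 + \<delta>) *\<^sub>R x) ` interior D" by simp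
    moreover have "(\<lambda>x. (1 + \<delta>) *\<^sub>R x) ` interior D \<subseteq> interior E"
      unfolding E_def using \<delta> interior_subset by (intro interior_maximal image_mono open_scaling) auto
    ultimately show "x \<in> interior E" by blast
  qed
  define W where "W = {u. \<forall>x\<in>D. u \<bullet> x \<le> 1}"
  have "frontier E \<subseteq> (\<Union>u\<in>W. {z. u \<bullet> z > 1})"
  proof
    fix y assume "y \<in> frontier E"
    then have "y \<notin> D" using intE by (auto simp: frontier_def)
    then obtain a b where ab: "a \<bullet> y < b" "\<And>x. x \<in> D \<Longrightarrow> b < a \<bullet> x"
      using separating_hyperplane_closed_point[OF D(2) compact_imp_closed[OF D(1)]] by blast
    \<comment> \<open>The origin lies in \<open>D\<close>, which fixes the sign of \<open>b\<close>.
      Dividing by it normalises the bound to 1 and reverses the inequalities.\<close>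
    have b: "b < 0" using ab(2)[of 0] 0 interior_subset by auto
    have "a /\<^sub>R b \<in> W" unfolding W_def using ab(2) b by (auto simp: field_simps less_imp_le)
    moreover have "(a /\<^sub>R b) \<bullet> y > 1" using ab(1) b by (simp add: field_simps)
    ultimately show "y \<in> (\<Union>u\<in>W. {z. u \<bullet> z > 1})" by blast
  qed
  moreover have "compact (frontier E)" using compE by (rule compact_frontier)
  ultimately obtain U where U: "U \<subseteq> W" "finite U" "frontier E \<subseteq> (\<Union>u\<in>U. {z. u \<bullet> z > 1})"
    using compactE_image[of "frontier E" W "\<lambda>u. {z. u \<bullet> z > 1}"] open_halfspace_gt by blast
  define P where "P = {x. \<forall>u\<in>U. u \<bullet> x \<le> 1}"
  have "P = (\<Inter>u\<in>U. {x. u \<bullet> x \<le> 1})" by (auto simp: P_def)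
  then have "convex P" by (auto intro!: convex_INT convex_halfspace_le)
  then have "connected P" by (rule convex_connected)
  moreover have "P \<inter> frontier E = {}"
    using U(3) by (force simp: P_def)
  moreover have "0 \<in> P" "0 \<in> E" using 0 intE interior_subset by (auto simp: P_def)
  ultimately have "P \<subseteq> E" using connected_Int_frontier[of P E] by blast
  then show thesis using that[of U] U by (auto simp: P_def E_def W_def)
qed

text \<open>The polytope estimate is applied to some \<open>P\<close> between \<open>D\<close> and
  \<open>(1 + \<delta>) D\<close>, and then \<open>\<delta>\<close> tends to zero.\<close>

lemma measure_plus_ge_of_no_fit_0:
  fixes K D :: "'a::euclidean_space set"
  assumes D: "compact D" "convex D" "0 \<in> interior D"
    and K: "compact K" "convex K" "0 \<in> K"
    and \<tau>: "0 < \<tau>" and nofit: "\<And>x. \<not> (\<lambda>k. x + \<tau> *\<^sub>R k) ` K \<subseteq> D" and N: "0 < (N :: nat)"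
  shows "(1 + 1 / N) * measure lebesgue D \<le> measure lebesgue (D + (\<lambda>k. (\<tau> / N) *\<^sub>R k) ` K)"
proof -
  define S where "S = D + (\<lambda>k. (\<tau> / N) *\<^sub>R k) ` K"
  have compS: "compact S" unfolding S_def using D K by (intro compact_set_plus compact_scaling)
  have ge: "(1 + 1 / N) * measure lebesgue D \<le> (1 + \<delta>) ^ DIM('a) * measure lebesgue S" if \<delta>: "0 < \<delta>" for \<delta>
  proof -
    obtain U where U: "finite U" "D \<subseteq> {x. \<forall>u\<in>U. u \<bullet> x \<le> 1}"
      "{x. \<forall>u\<in>U. u \<bullet> x \<le> 1} \<subseteq> (\<lambda>x. (1 + \<delta>) *\<^sub>R x) ` D"
      using polytope_between[OF D \<delta>] by blast
    define P where "P = {x. \<forall>u\<in>U. u \<bullet> x \<le> 1}"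
    have "P = (\<Inter>u\<in>U. {x. u \<bullet> x \<le> 1})" by (auto simp: P_def)
    then have "closed P" by (auto intro!: closed_INT closed_halfspace_le)
    moreover have "bounded P"
      using bounded_subset[OF compact_imp_bounded[OF compact_scaling[OF D(1)]]] U(3) by (simp add: P_def)
    ultimately have P: "compact P" by (simp add: compact_eq_bounded_closed)
    \<comment> \<open>Since \<open>P\<close> may be larger than \<open>D\<close>, a copy of
      \<open>\<tau> K\<close> might fit into it. Enlarging \<open>\<tau>\<close> by the same factor
      \<open>1 + \<delta>\<close> excludes this.\<close>
    have nf: "\<not> (\<lambda>k. x + ((1 + \<delta>) * \<tau>) *\<^sub>R k) ` K \<subseteq> P" for x
    proof
      assume *: "(\<lambda>k. x + ((1 + \<delta>) * \<tau>) *\<^sub>R k) ` K \<subseteq> P"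
      have "x /\<^sub>R (1 + \<delta>) + \<tau> *\<^sub>R k \<in> D" if "k \<in> K" for k
      proof -
        have "x + ((1 + \<delta>) * \<tau>) *\<^sub>R k \<in> (\<lambda>x. (1 + \<delta>) *\<^sub>R x) ` D"
          using * U(3) that by (auto simp: P_def)
        then obtain d where d: "d \<in> D" "x + ((1 + \<delta>) * \<tau>) *\<^sub>R k = (1 + \<delta>) *\<^sub>R d" by blast
        have "x /\<^sub>R (1 + \<delta>) + \<tau> *\<^sub>R k = (x + ((1 + \<delta>) * \<tau>) *\<^sub>R k) /\<^sub>R (1 + \<delta>)"
          using \<delta> by (simp add: scaleR_right_distrib)
        then show ?thesis using d \<delta> by simp
      qed
      then show False using nofit[of "x /\<^sub>R (1 + \<delta>)"] by blast
    qed
    have "(1 + 1 / N) * measure lebesgue D \<le> (1 + 1 / N) * measure lebesgue P"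
      using U(2) D P by (intro mult_left_mono measure_mono_fmeasurable)
        (auto simp: P_def[symmetric] lmeasurable_compact fmeasurableD)
    also have "\<dots> \<le> measure lebesgue (P + (\<lambda>k. ((1 + \<delta>) * \<tau> / N) *\<^sub>R k) ` K)"
      using measure_polytope_plus_ge[of U K "(1 + \<delta>) * \<tau>" N] U(1) P K \<tau> \<delta> nf N by (simp add: P_def)
    also have "\<dots> \<le> measure lebesgue ((\<lambda>x. (1 + \<delta>) *\<^sub>R x) ` S)"
    proof (intro measure_mono_fmeasurable)
      show "P + (\<lambda>k. ((1 + \<delta>) * \<tau> / N) *\<^sub>R k) ` K \<subseteq> (\<lambda>x. (1 + \<delta>) *\<^sub>R x) ` S"
      proof
        fix z assume "z \<in> P + (\<lambda>k. ((1 + \<delta>) * \<tau> / N) *\<^sub>R k) ` K"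
        then obtain p k where p: "p \<in> P" "k \<in> K" "z = p + ((1 + \<delta>) * \<tau> / N) *\<^sub>R k"
          by (auto elim!: set_plus_elim)
        then obtain d where d: "d \<in> D" "p = (1 + \<delta>) *\<^sub>R d" using U(3) by (auto simp: P_def)
        have "z = (1 + \<delta>) *\<^sub>R (d + (\<tau> / N) *\<^sub>R k)"
          by (simp add: p(3) d(2) scaleR_right_distrib)
        moreover have "d + (\<tau> / N) *\<^sub>R k \<in> S"
          unfolding S_def using d p by (intro set_plus_intro) auto
        ultimately show "z \<in> (\<lambda>x. (1 + \<delta>) *\<^sub>R x) ` S" by blast
      qed
      show "P + (\<lambda>k. ((1 + \<delta>) * \<tau> / N) *\<^sub>R k) ` K \<in> sets lebesgue"
        by (intro fmeasurableD lmeasurable_compact compact_set_plus compact_scaling P K)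
      show "(\<lambda>x. (1 + \<delta>) *\<^sub>R x) ` S \<in> lmeasurable"
        by (intro lmeasurable_compact compact_scaling compS)
    qed
    also have "\<dots> = (1 + \<delta>) ^ DIM('a) * measure lebesgue S"
      using measure_lebesgue_affine[of "1 + \<delta>" 0 S] \<delta> by simp
    finally show ?thesis .
  qed
  have "((\<lambda>\<delta>. (1 + \<delta>) ^ DIM('a) * measure lebesgue S) \<longlongrightarrow> (1 + 0) ^ DIM('a) * measure lebesgue S) (at_right 0)"
    by (intro tendsto_intros)
  moreover have "\<forall>\<^sub>F \<delta> in at_right 0. (1 + 1 / N) * measure lebesgue D \<le> (1 + \<delta>) ^ DIM('a) * measure lebesgue S"
    using ge by (intro eventually_at_rightI[of 0 1]) auto
  ultimately have "(1 + 1 / N) * measure lebesgue D \<le> (1 + 0) ^ DIM('a) * measure lebesgue S"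
    by (rule tendsto_lowerbound) simp
  then show ?thesis by (simp add: S_def)
qed

text \<open>Fitting and volume are unaffected by translating \<open>D\<close> and \<open>K\<close>
  separately, so the origin may be moved into the interior of \<open>D\<close> and into
  \<open>K\<close>.\<close>

lemma measure_plus_ge_of_no_fit:
  fixes K D :: "'a::euclidean_space set"
  assumes D: "convex_body D" "interior D \<noteq> {}" and K: "convex_body K"
    and \<tau>: "0 < \<tau>" and nofit: "\<And>x. \<not> (\<lambda>k. x + \<tau> *\<^sub>R k) ` K \<subseteq> D" and N: "0 < (N :: nat)"
  shows "(1 + 1 / N) * measure lebesgue D \<le> measure lebesgue (D + (\<lambda>k. (\<tau> / N) *\<^sub>R k) ` K)"
proof -
  obtain d where d: "d \<in> interior D" using D by blast
  obtain k0 where k0: "k0 \<in> K" using K by (auto simp: convex_body_def)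
  define D' where "D' = (+) (- d) ` D"
  define K' where "K' = (+) (- k0) ` K"
  have nofit': "\<not> (\<lambda>k. x + \<tau> *\<^sub>R k) ` K' \<subseteq> D'" for x
  proof
    assume *: "(\<lambda>k. x + \<tau> *\<^sub>R k) ` K' \<subseteq> D'"
    have "(x + d - \<tau> *\<^sub>R k0) + \<tau> *\<^sub>R k \<in> D" if "k \<in> K" for k
    proof -
      have "x + \<tau> *\<^sub>R (- k0 + k) \<in> D'" using * that by (auto simp: K'_def)
      then obtain y where "y \<in> D" "x + \<tau> *\<^sub>R (- k0 + k) = - d + y" by (auto simp: D'_def)
      then have "(x + d - \<tau> *\<^sub>R k0) + \<tau> *\<^sub>R k = y"
        by (simp add: algebra_simps)
      then show ?thesis using \<open>y \<in> D\<close> by simp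
    qed
    then show False using nofit[of "x + d - \<tau> *\<^sub>R k0"] by blast
  qed
  have "0 \<in> interior D'"
    unfolding D'_def interior_translation using d by force
  moreover have "compact D'" "convex D'" "compact K'" "convex K'"
    unfolding D'_def K'_def using D K by (simp_all only: convex_body_def compact_translation convex_translation)
  moreover have "0 \<in> K'" unfolding K'_def using k0 by (intro image_eqI[of _ _ k0]) simp_all
  ultimately have "(1 + 1 / N) * measure lebesgue D' \<le> measure lebesgue (D' + (\<lambda>k. (\<tau> / N) *\<^sub>R k) ` K')"
    using measure_plus_ge_of_no_fit_0[of D' K' \<tau> N] \<tau> nofit' N by blast
  moreover have "D' + (\<lambda>k. (\<tau> / N) *\<^sub>R k) ` K' = (+) (- d - (\<tau> / N) *\<^sub>R k0) ` (D + (\<lambda>k. (\<tau> / N) *\<^sub>R k) ` K)"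
  proof (intro equalityI subsetI)
    fix z assume "z \<in> D' + (\<lambda>k. (\<tau> / N) *\<^sub>R k) ` K'"
    then obtain y k where y: "y \<in> D" "k \<in> K" "z = (- d + y) + (\<tau> / N) *\<^sub>R (- k0 + k)"
      by (auto simp: D'_def K'_def elim!: set_plus_elim)
    have "z = (- d - (\<tau> / N) *\<^sub>R k0) + (y + (\<tau> / N) *\<^sub>R k)"
      by (simp add: y(3) scaleR_diff_right scaleR_right_distrib)
    moreover have "y + (\<tau> / N) *\<^sub>R k \<in> D + (\<lambda>k. (\<tau> / N) *\<^sub>R k) ` K" using y by (intro set_plus_intro) auto
    ultimately show "z \<in> (+) (- d - (\<tau> / N) *\<^sub>R k0) ` (D + (\<lambda>k. (\<tau> / N) *\<^sub>R k) ` K)" by blast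
  next
    fix z assume "z \<in> (+) (- d - (\<tau> / N) *\<^sub>R k0) ` (D + (\<lambda>k. (\<tau> / N) *\<^sub>R k) ` K)"
    then obtain y k where y: "y \<in> D" "k \<in> K" "z = (- d - (\<tau> / N) *\<^sub>R k0) + (y + (\<tau> / N) *\<^sub>R k)"
      by (auto elim!: set_plus_elim)
    have "z = (- d + y) + (\<tau> / N) *\<^sub>R (- k0 + k)"
      by (simp add: y(3) scaleR_diff_right scaleR_right_distrib)
    then show "z \<in> D' + (\<lambda>k. (\<tau> / N) *\<^sub>R k) ` K'"
      unfolding D'_def K'_def using y(1,2) by (simp only:) (intro set_plus_intro imageI)
  qed
  ultimately show ?thesis by (simp only: D'_def measure_translation)
qed

section \<open>The Bezout inequality\<close>

lemma sum_multi_indices_2: "(\<Sum>e\<in>multi_indices 2 n. f e) = (\<Sum>i\<le>n. f [i, n - i])"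
proof -
  have "multi_indices 2 n = (\<lambda>i. [i, n - i]) ` {..n}"
    by (auto simp: multi_indices_def length_Suc_conv numeral_2_eq_2)
  moreover have "inj_on (\<lambda>i. [i, n - i]) {..n}" by (auto simp: inj_on_def)
  ultimately show ?thesis by (simp add: sum.reindex)
qed

lemma minkowski_comb_pair:
  "minkowski_comb [K, D] (\<lambda>j. if j = 0 then h else 1) = D + (\<lambda>k. h *\<^sub>R k) ` K"
  by (simp add: minkowski_comb_def lessThan_Suc add.commute)

lemma steiner_polynomial:
  fixes K D :: "(real ^ 'n) set"
  assumes K: "convex_body K" and D: "convex_body D" and h: "0 \<le> h"
  shows "vol (D + (\<lambda>k. h *\<^sub>R k) ` K)
    = (\<Sum>i\<le>CARD('n). real (CARD('n) choose i) * mixed_volume [K, D] [i, CARD('n) - i] * h ^ i)"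
proof -
  have "mixed_volume_coeffs [K, D] (mixed_volume [K, D])"
    by (rule mixed_volume_coeffs_mixed_volume) (use K D in simp)
  then have "vol (minkowski_comb [K, D] (\<lambda>j. if j = 0 then h else 1))
    = (\<Sum>e\<in>multi_indices 2 CARD('n). fact CARD('n) / (\<Prod>j<2. fact (e ! j)) * mixed_volume [K, D] e
         * (\<Prod>j<2. (if j = 0 then h else 1) ^ (e ! j)))"
    using h unfolding mixed_volume_coeffs_def by (simp add: numeral_2_eq_2)
  then show ?thesis
    unfolding minkowski_comb_pair sum_multi_indices_2
    by (simp add: numeral_2_eq_2 lessThan_Suc binomial_fact mult.commute)
qed

text \<open>In other words, the inradius of \<open>D\<close> relative to \<open>K\<close> is at least
  \<open>vol D / (n V(K, D\<^bsup>n-1\<^esup>))\<close>.\<close>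

lemma subset_scaled_translate:
  fixes K D :: "(real ^ 'n) set"
  assumes K: "convex_body K" and D: "convex_body D" and pos: "0 < vol D" and \<mu>: "0 < \<mu>"
    and big: "CARD('n) * mixed_volume [K, D] [1, CARD('n) - 1] < \<mu> * vol D"
  shows "\<exists>x. K \<subseteq> (\<lambda>y. x + \<mu> *\<^sub>R y) ` D"
proof (rule ccontr)
  assume no: "\<nexists>x. K \<subseteq> (\<lambda>y. x + \<mu> *\<^sub>R y) ` D"
  have nofit: "\<not> (\<lambda>k. x + (1 / \<mu>) *\<^sub>R k) ` K \<subseteq> D" for x
  proof
    assume *: "(\<lambda>k. x + (1 / \<mu>) *\<^sub>R k) ` K \<subseteq> D"
    have "k \<in> (\<lambda>y. (- \<mu> *\<^sub>R x) + \<mu> *\<^sub>R y) ` D" if "k \<in> K" for k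
    proof (rule image_eqI)
      show "x + (1 / \<mu>) *\<^sub>R k \<in> D" using * that by blast
      show "k = (- \<mu> *\<^sub>R x) + \<mu> *\<^sub>R (x + (1 / \<mu>) *\<^sub>R k)"
        using \<mu> by (simp add: scaleR_right_distrib)
    qed
    then show False using no by blast
  qed
  have int: "interior D \<noteq> {}"
    using pos D negligible_convex_interior[of D] negligible_imp_measure0[of D] by (auto simp: convex_body_def)
  define a where "a i = real (CARD('n) choose i) * mixed_volume [K, D] [i, CARD('n) - i]" for i
  define p where "p h = (\<Sum>i\<le>CARD('n). a i * h ^ i)" for h :: real
  have p: "vol (D + (\<lambda>k. h *\<^sub>R k) ` K) = p h" if "0 \<le> h" for h
    unfolding p_def a_def by (rule steiner_polynomial[OF K D that])
  have "(\<lambda>k. 0 *\<^sub>R k) ` K = 0" using K by (auto simp: convex_body_def)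
  then have p0: "p 0 = vol D" using p[of 0] by (simp del: scaleR_zero_left)
  have "(p has_real_derivative (\<Sum>i\<le>CARD('n). a i * (real i * 0 ^ (i - 1)))) (at 0)"
    unfolding p_def by (auto intro!: derivative_eq_intros sum.cong)
  \<comment> \<open>Only the linear term survives at zero: \<open>0 ^ (i - 1)\<close> is 1 for
    \<open>i = 0\<close> as well, but there the factor \<open>real i\<close> vanishes.\<close>
  moreover have "(\<Sum>i\<le>CARD('n). a i * (real i * 0 ^ (i - 1))) = (\<Sum>i\<le>CARD('n). if i = 1 then a 1 else 0)"
    by (intro sum.cong refl) (auto simp: power_0_left)
  moreover have "(\<Sum>i\<le>CARD('n). if i = 1 then a 1 else 0) = a 1"
    by (simp add: Suc_le_eq)
  ultimately have "(\<lambda>h. (p (0 + h) - p 0) / h) \<midarrow>0\<rightarrow> a 1"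
    by (simp add: DERIV_def)
  moreover have "filterlim (\<lambda>N. (1 / \<mu>) / real (Suc N)) (at 0) sequentially"
    unfolding filterlim_at
    using \<mu> lim_const_over_n[of "1 / \<mu>", THEN LIMSEQ_Suc] by auto
  ultimately have lim: "(\<lambda>N. (p (0 + (1 / \<mu>) / real (Suc N)) - p 0) / ((1 / \<mu>) / real (Suc N))) \<longlonglongrightarrow> a 1"
    by (rule filterlim_compose)
  \<comment> \<open>With \<open>\<tau> = 1 / \<mu>\<close> the increment of \<open>p\<close> at
    \<open>h = \<tau> / Suc N\<close> is at least \<open>vol D / Suc N\<close>. Dividing by
    \<open>h\<close> removes \<open>N\<close> from the bound.\<close>
  have "\<mu> * vol D \<le> (p (0 + (1 / \<mu>) / real (Suc N)) - p 0) / ((1 / \<mu>) / real (Suc N))" for N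
  proof -
    have "(1 + 1 / real (Suc N)) * vol D \<le> p ((1 / \<mu>) / real (Suc N))"
      using measure_plus_ge_of_no_fit[OF D int K _ nofit, of "Suc N"] \<mu>
        p[of "(1 / \<mu>) / real (Suc N)"] by simp
    then have "vol D / real (Suc N) \<le> p ((1 / \<mu>) / real (Suc N)) - p 0"
      by (simp add: p0 distrib_right)
    then have "(vol D / real (Suc N)) / ((1 / \<mu>) / real (Suc N))
        \<le> (p ((1 / \<mu>) / real (Suc N)) - p 0) / ((1 / \<mu>) / real (Suc N))"
      using \<mu> by (intro divide_right_mono) auto
    then show ?thesis using \<mu> by (simp add: mult.commute)
  qed
  then have "\<mu> * vol D \<le> a 1" using lim by (intro LIMSEQ_le_const) auto
  then show False using big by (simp add: a_def)
qed

section \<open>Replacing a body by a scaled translate of \<open>D\<close>\<close>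

lemma convex_scaled_plus:
  assumes "convex S" "0 \<le> a" "0 \<le> b" "x \<in> S" "y \<in> S"
  obtains z where "z \<in> S" "a *\<^sub>R x + b *\<^sub>R y = (a + b) *\<^sub>R z"
proof (cases "a + b = 0")
  case True
  then have "a = 0" "b = 0" using assms by auto
  then show ?thesis using that[of x] assms by simp
next
  case False
  then have ab: "0 < a + b" using assms by simp
  have "(a / (a + b)) *\<^sub>R x + (b / (a + b)) *\<^sub>R y \<in> S"
    using assms ab by (intro convexD) (auto simp: add_divide_distrib[symmetric])
  moreover have "a *\<^sub>R x + b *\<^sub>R y = (a + b) *\<^sub>R ((a / (a + b)) *\<^sub>R x + (b / (a + b)) *\<^sub>R y)"
    using ab by (simp add: scaleR_right_distrib)
  ultimately show ?thesis using that by blast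
qed

text \<open>The first body merges with the last one because multiples of a convex set add up:
  \<open>a D + b D = (a + b) D\<close> for nonnegative \<open>a\<close> and \<open>b\<close>. The
  shift by \<open>x\<close> factors out as a translation, which does not affect volume.\<close>

lemma minkowski_comb_scaled_translate:
  fixes D :: "'a::real_vector set"
  assumes D: "convex D" and \<mu>: "0 \<le> \<mu>" and t: "0 \<le> t 0" "0 \<le> t (Suc (length Ks))"
  shows "minkowski_comb ((\<lambda>y. x + \<mu> *\<^sub>R y) ` D # Ks @ [D]) t
    = (+) (t 0 *\<^sub>R x) ` minkowski_comb (Ks @ [D])
        (\<lambda>j. if j < length Ks then t (Suc j) else t (Suc (length Ks)) + \<mu> * t 0)"
    (is "?L = (+) _ ` ?R")
proof -
  let ?m = "length Ks"
  have L: "minkowski_comb ((\<lambda>y. x + \<mu> *\<^sub>R y) ` D # Ks @ [D]) t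
     = {t 0 *\<^sub>R (x + \<mu> *\<^sub>R d) + ((\<Sum>j<?m. t (Suc j) *\<^sub>R y j) + t (Suc ?m) *\<^sub>R d') | d y d'.
          d \<in> D \<and> (\<forall>j<?m. y j \<in> Ks ! j) \<and> d' \<in> D}" (is "_ = ?L'")
  proof (intro equalityI subsetI)
    fix z assume "z \<in> ?L"
    then obtain y where z: "z = (\<Sum>j<Suc (Suc ?m). t j *\<^sub>R y j)"
      and y: "\<And>j. j < Suc (Suc ?m) \<Longrightarrow> y j \<in> ((\<lambda>y. x + \<mu> *\<^sub>R y) ` D # Ks @ [D]) ! j"
      unfolding minkowski_comb_eq by auto
    obtain d where d: "d \<in> D" "y 0 = x + \<mu> *\<^sub>R d" using y[of 0] by auto
    have "y (Suc j) \<in> Ks ! j" if "j < ?m" for j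
      using y[of "Suc j"] that by (simp add: nth_append)
    moreover have "y (Suc ?m) \<in> D"
      using y[of "Suc ?m"] by (simp add: nth_append)
    moreover have "z = t 0 *\<^sub>R (x + \<mu> *\<^sub>R d) + ((\<Sum>j<?m. t (Suc j) *\<^sub>R y (Suc j)) + t (Suc ?m) *\<^sub>R y (Suc ?m))"
      unfolding z sum.lessThan_Suc_shift[of _ "Suc ?m"] by (simp add: d)
    ultimately show "z \<in> ?L'" using d(1)
      by (intro CollectI exI[of _ d] exI[of _ "\<lambda>j. y (Suc j)"] exI[of _ "y (Suc ?m)"]) simp
  next
    fix z assume "z \<in> ?L'"
    then obtain d y d' where z: "z = t 0 *\<^sub>R (x + \<mu> *\<^sub>R d) + ((\<Sum>j<?m. t (Suc j) *\<^sub>R y j) + t (Suc ?m) *\<^sub>R d')"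
      and d: "d \<in> D" "\<forall>j<?m. y j \<in> Ks ! j" "d' \<in> D" by blast
    define u where "u j = (case j of 0 \<Rightarrow> x + \<mu> *\<^sub>R d | Suc i \<Rightarrow> if i < ?m then y i else d')" for j
    have "z = (\<Sum>j<Suc (Suc ?m). t j *\<^sub>R u j)"
      unfolding z sum.lessThan_Suc_shift[of _ "Suc ?m"] by (simp add: u_def)
    moreover have "u j \<in> ((\<lambda>y. x + \<mu> *\<^sub>R y) ` D # Ks @ [D]) ! j" if j: "j < Suc (Suc ?m)" for j
    proof (cases j)
      case 0
      then show ?thesis using d(1) by (auto simp: u_def)
    next
      case (Suc i)
      then show ?thesis using d(2,3) j by (cases "i < ?m") (simp_all add: u_def nth_append)
    qed
    ultimately show "z \<in> ?L"
      unfolding minkowski_comb_eq by (intro CollectI exI[of _ u]) simp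
  qed
  have R: "?R = {(\<Sum>j<?m. t (Suc j) *\<^sub>R y j) + (t (Suc ?m) + \<mu> * t 0) *\<^sub>R d | y d.
          (\<forall>j<?m. y j \<in> Ks ! j) \<and> d \<in> D}" (is "_ = ?R'")
  proof (intro equalityI subsetI)
    fix z assume "z \<in> ?R"
    then obtain y where z: "z = (\<Sum>j<Suc ?m. (if j < ?m then t (Suc j) else t (Suc ?m) + \<mu> * t 0) *\<^sub>R y j)"
      and y: "\<And>j. j < Suc ?m \<Longrightarrow> y j \<in> (Ks @ [D]) ! j"
      unfolding minkowski_comb_eq length_append_singleton by blast
    have "y j \<in> Ks ! j" if "j < ?m" for j
      using y[of j] that by (simp add: nth_append)
    moreover have "y ?m \<in> D"
      using y[of ?m] by (simp add: nth_append)
    ultimately show "z \<in> ?R'" unfolding z by (intro CollectI exI[of _ y] exI[of _ "y ?m"]) simp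
  next
    fix z assume "z \<in> ?R'"
    then obtain y d where z: "z = (\<Sum>j<?m. t (Suc j) *\<^sub>R y j) + (t (Suc ?m) + \<mu> * t 0) *\<^sub>R d"
      and d: "\<forall>j<?m. y j \<in> Ks ! j" "d \<in> D" by blast
    show "z \<in> ?R"
      unfolding minkowski_comb_eq z
      by (intro CollectI exI[of _ "\<lambda>j. if j < ?m then y j else d"])
        (use d in \<open>auto simp: nth_append less_Suc_eq\<close>)
  qed
  show ?thesis unfolding L R
  proof (intro equalityI subsetI)
    fix z assume "z \<in> ?L'"
    then obtain d y d' where z: "z = t 0 *\<^sub>R (x + \<mu> *\<^sub>R d) + ((\<Sum>j<?m. t (Suc j) *\<^sub>R y j) + t (Suc ?m) *\<^sub>R d')"
      and d: "d \<in> D" "\<forall>j<?m. y j \<in> Ks ! j" "d' \<in> D" by blast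
    obtain c where c: "c \<in> D" "t (Suc ?m) *\<^sub>R d' + (\<mu> * t 0) *\<^sub>R d = (t (Suc ?m) + \<mu> * t 0) *\<^sub>R c"
      using convex_scaled_plus[OF D t(2) _ d(3,1), of "\<mu> * t 0"] \<mu> t by auto
    have "z = t 0 *\<^sub>R x + ((\<Sum>j<?m. t (Suc j) *\<^sub>R y j) + (t (Suc ?m) + \<mu> * t 0) *\<^sub>R c)"
      unfolding z c(2)[symmetric] by (simp add: scaleR_right_distrib mult.commute)
    then show "z \<in> (+) (t 0 *\<^sub>R x) ` ?R'" using c(1) d(2) by blast
  next
    fix z assume "z \<in> (+) (t 0 *\<^sub>R x) ` ?R'"
    then obtain y d where z: "z = t 0 *\<^sub>R x + ((\<Sum>j<?m. t (Suc j) *\<^sub>R y j) + (t (Suc ?m) + \<mu> * t 0) *\<^sub>R d)"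
      and d: "\<forall>j<?m. y j \<in> Ks ! j" "d \<in> D" by blast
    have "z = t 0 *\<^sub>R (x + \<mu> *\<^sub>R d) + ((\<Sum>j<?m. t (Suc j) *\<^sub>R y j) + t (Suc ?m) *\<^sub>R d)"
      unfolding z by (simp add: scaleR_right_distrib scaleR_left_distrib mult.commute)
    then show "z \<in> ?L'" using d by blast
  qed
qed

lemma multi_index_split:
  assumes "e \<in> multi_indices (Suc m) n"
  obtains e' l where "e = e' @ [l]" "length e' = m" "sum_list e' + l = n"
proof
  have "e \<noteq> []" using assms by (auto simp: multi_indices_def)
  then show eq: "e = butlast e @ [last e]" by simp
  show "length (butlast e) = m" using assms by (simp add: multi_indices_def)
  show "sum_list (butlast e) + last e = n"
    using assms arg_cong[OF eq, of sum_list] by (simp add: multi_indices_def)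
qed

text \<open>The volume polynomial of the longer list arises from that of \<open>Ks @ [D]\<close> by
  substituting \<open>t (Suc m) + \<mu> * t 0\<close> for its last variable, where \<open>m\<close>
  is the length of \<open>Ks\<close>. A mixed volume is accessible only through a complete family of
  coefficients, so all of them are computed although the claim concerns the exponent 1 of the first
  body.\<close>

lemma mixed_volume_scaled_translate:
  fixes D :: "(real ^ 'n) set"
  assumes Ks: "\<forall>K\<in>set Ks. convex_body K" and D: "convex_body D" and \<mu>: "0 < \<mu>"
    and e: "length e = length Ks" "sum_list e + Suc k = CARD('n)"
  shows "mixed_volume ((\<lambda>y. x + \<mu> *\<^sub>R y) ` D # Ks @ [D]) (1 # e @ [k])
    = \<mu> * mixed_volume (Ks @ [D]) (e @ [Suc k])"
proof -
  let ?m = "length Ks" and ?n = "CARD('n)"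
  define V where "V = mixed_volume (Ks @ [D])"
  have V: "mixed_volume_coeffs (Ks @ [D]) V"
    unfolding V_def by (rule mixed_volume_coeffs_mixed_volume) (use Ks D in auto)
  \<comment> \<open>The exponent of the scaled translate is added to that of \<open>D\<close>, with
    one factor \<open>\<mu>\<close> for each copy.\<close>
  define c where "c E = \<mu> ^ hd E * V (butlast (tl E) @ [last E + hd E])" for E
  \<comment> \<open>\<open>up\<close> and \<open>down\<close> are inverse to each other between
    exponent lists of the longer list and pairs of an exponent list \<open>e\<close> for
    \<open>Ks @ [D]\<close> and an index \<open>i \<le> last e\<close> of the binomial
    expansion.\<close>
  define up where "up = (\<lambda>(e :: nat list, i). i # butlast e @ [last e - i])"
  define down where "down E = (butlast (tl E) @ [last E + hd E], hd E)" for E :: "nat list"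
  let ?Ls = "(\<lambda>y. x + \<mu> *\<^sub>R y) ` D # Ks @ [D]"
  have lenLs: "length ?Ls = Suc (Suc ?m)" by simp
  have ends: "(\<Prod>j<Suc (Suc ?m). g j) = g 0 * ((\<Prod>j<?m. g (Suc j)) * g (Suc ?m))" for g :: "nat \<Rightarrow> real"
    by (subst prod.lessThan_Suc_shift) simp
  have "mixed_volume_coeffs ?Ls c"
    unfolding mixed_volume_coeffs_def
  proof (intro allI impI)
    fix t :: "nat \<Rightarrow> real" assume "\<forall>j<length ?Ls. 0 \<le> t j"
    then have t: "0 \<le> t j" if "j < Suc (Suc ?m)" for j using that by simp
    let ?t = "\<lambda>j. if j < ?m then t (Suc j) else t (Suc ?m) + \<mu> * t 0"
    let ?f = "\<lambda>E. fact ?n / (\<Prod>j<length ?Ls. fact (E ! j)) * c E * (\<Prod>j<length ?Ls. t j ^ (E ! j)) :: real"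
    have "vol (minkowski_comb ?Ls t) = vol (minkowski_comb (Ks @ [D]) ?t)"
      using D \<mu> t by (subst minkowski_comb_scaled_translate) (auto simp: convex_body_def measure_translation)
    also have "\<dots> = (\<Sum>e\<in>multi_indices (Suc ?m) ?n.
        fact ?n / (\<Prod>j<Suc ?m. fact (e ! j)) * V e * (\<Prod>j<Suc ?m. ?t j ^ (e ! j)))"
    proof -
      have "\<forall>j<length (Ks @ [D]). 0 \<le> ?t j" using t \<mu> by auto
      then show ?thesis using V[unfolded mixed_volume_coeffs_def, rule_format, of ?t] by simp
    qed
    also have "\<dots> = (\<Sum>e\<in>multi_indices (Suc ?m) ?n. \<Sum>i\<le>last e. ?f (up (e, i)))"
    proof (rule sum.cong[OF refl])
      fix e assume "e \<in> multi_indices (Suc ?m) ?n"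
      then obtain e' l where e: "e = e' @ [l]" "length e' = ?m" "sum_list e' + l = ?n"
        by (rule multi_index_split)
      define A where "A = (\<Prod>j<?m. fact (e' ! j) :: real)"
      define Q where "Q = (\<Prod>j<?m. t (Suc j) ^ (e' ! j))"
      have "A \<noteq> 0" by (simp add: A_def)
      have f: "?f (up (e, i)) = fact ?n / (fact i * A * fact (l - i)) * (\<mu> ^ i * V e) * (t 0 ^ i * Q * t (Suc ?m) ^ (l - i))"
        if "i \<le> l" for i
      proof -
        have "(\<Prod>j<?m. fact ((e' @ [l - i]) ! j)) = A"
          unfolding A_def by (intro prod.cong) (auto simp: nth_append e)
        moreover have "(\<Prod>j<?m. t (Suc j) ^ ((e' @ [l - i]) ! j)) = Q"
          unfolding Q_def by (intro prod.cong) (auto simp: nth_append e)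
        moreover have "(e' @ [l - i]) ! ?m = l - i" using e(2) by (simp add: nth_append)
        moreover have "c (up (e, i)) = \<mu> ^ i * V e"
          using that by (simp add: c_def up_def e)
        ultimately show ?thesis
          unfolding lenLs ends by (simp add: e(1) up_def)
      qed
      have "(\<Prod>j<Suc ?m. fact (e ! j)) = A * (fact l :: real)"
        unfolding A_def using e by (simp add: nth_append)
      moreover have "(\<Prod>j<Suc ?m. ?t j ^ (e ! j)) = Q * (t (Suc ?m) + \<mu> * t 0) ^ l"
        unfolding Q_def using e by (simp add: nth_append)
      moreover have "(t (Suc ?m) + \<mu> * t 0) ^ l
          = (\<Sum>i\<le>l. fact l / (fact i * fact (l - i)) * (\<mu> * t 0) ^ i * t (Suc ?m) ^ (l - i))"
        unfolding add.commute[of "t (Suc ?m)"] binomial_ring by (simp add: binomial_fact)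
      ultimately have "fact ?n / (\<Prod>j<Suc ?m. fact (e ! j)) * V e * (\<Prod>j<Suc ?m. ?t j ^ (e ! j))
        = fact ?n / (A * fact l) * V e * (Q * (\<Sum>i\<le>l. fact l / (fact i * fact (l - i)) * (\<mu> * t 0) ^ i * t (Suc ?m) ^ (l - i)))"
        by simp
      also have "\<dots> = (\<Sum>i\<le>l. ?f (up (e, i)))"
        unfolding sum_distrib_left
      proof (rule sum.cong[OF refl])
        \<comment> \<open>The factorial \<open>fact l\<close> of the binomial coefficient cancels
          against the multinomial one, leaving the multinomial coefficient of the longer
          list.\<close>
        fix i assume "i \<in> {..l}"
        then show "fact ?n / (A * fact l) * V e * (Q * (fact l / (fact i * fact (l - i)) * (\<mu> * t 0) ^ i * t (Suc ?m) ^ (l - i)))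
          = ?f (up (e, i))"
          using \<open>A \<noteq> 0\<close> by (subst f) (simp_all add: power_mult_distrib ac_simps)
      qed
      finally show "fact ?n / (\<Prod>j<Suc ?m. fact (e ! j)) * V e * (\<Prod>j<Suc ?m. ?t j ^ (e ! j))
          = (\<Sum>i\<le>last e. ?f (up (e, i)))"
        by (simp add: e(1))
    qed
    also have "\<dots> = (\<Sum>p\<in>Sigma (multi_indices (Suc ?m) ?n) (\<lambda>e. {..last e}). ?f (up p))"
      by (subst sum.Sigma) (auto simp: finite_multi_indices intro!: sum.cong)
    also have "\<dots> = (\<Sum>E\<in>multi_indices (Suc (Suc ?m)) ?n. ?f E)"
    proof (rule sum.reindex_bij_witness[of _ down up])
      fix p assume p: "p \<in> Sigma (multi_indices (Suc ?m) ?n) (\<lambda>e. {..last e})"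
      obtain e i where ei: "p = (e, i)" by (cases p)
      then have "e \<in> multi_indices (Suc ?m) ?n" "i \<le> last e" using p by auto
      then obtain e' l where e: "e = e' @ [l]" "length e' = ?m" "sum_list e' + l = ?n" "i \<le> l"
        by (metis last_snoc multi_index_split)
      show "down (up p) = p" using e by (simp add: ei up_def down_def)
      show "up p \<in> multi_indices (Suc (Suc ?m)) ?n"
        using e by (simp add: ei up_def multi_indices_def)
    next
      fix E assume E: "E \<in> multi_indices (Suc (Suc ?m)) ?n"
      then obtain i F where F: "E = i # F" "F \<in> multi_indices (Suc ?m) (?n - i)" "i \<le> ?n"
        by (cases E) (auto simp: multi_indices_def)
      then obtain e' l where e: "F = e' @ [l]" "length e' = ?m" "sum_list e' + l = ?n - i"
        by (metis multi_index_split)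
      show "up (down E) = E" using e F by (simp add: up_def down_def)
      show "down E \<in> Sigma (multi_indices (Suc ?m) ?n) (\<lambda>e. {..last e})"
        using e F by (simp add: down_def multi_indices_def)
    qed simp
    finally show "vol (minkowski_comb ?Ls t) = (\<Sum>E\<in>multi_indices (length ?Ls) ?n. ?f E)" by simp
  qed
  moreover have "1 # e @ [k] \<in> multi_indices (length ?Ls) ?n"
    using e by (simp add: multi_indices_def)
  ultimately have "mixed_volume ?Ls (1 # e @ [k]) = c (1 # e @ [k])" by (rule mixed_volume_eqI)
  then show ?thesis by (simp add: c_def V_def)
qed

text \<open>A translate of \<open>\<mu> D\<close> contains \<open>K\<close> as soon as
  \<open>\<mu>\<close> is strictly larger than \<open>n V(K, D^(n-1)) / vol D\<close>. Monotonicity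
  then replaces \<open>K\<close> by this translate, and the bound at the critical value of
  \<open>\<mu>\<close> follows as a limit from the right.\<close>

lemma mixed_volume_peel:
  fixes D :: "(real ^ 'n) set"
  assumes K: "convex_body K" and Ks: "\<forall>K\<in>set Ks. convex_body K" and D: "convex_body D"
    and pos: "0 < vol D" and len: "Suc (length Ks) \<le> CARD('n)"
  shows "mixed_volume (K # Ks @ [D]) (1 # replicate (length Ks) 1 @ [CARD('n) - Suc (length Ks)]) * vol D
    \<le> CARD('n) * mixed_volume [K, D] [1, CARD('n) - 1]
       * mixed_volume (Ks @ [D]) (replicate (length Ks) 1 @ [CARD('n) - length Ks])"
proof -
  define W where "W = mixed_volume (K # Ks @ [D]) (1 # replicate (length Ks) 1 @ [CARD('n) - Suc (length Ks)])"
  define w where "w = mixed_volume (Ks @ [D]) (replicate (length Ks) 1 @ [CARD('n) - length Ks])"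
  define v where "v = CARD('n) * mixed_volume [K, D] [1, CARD('n) - 1]"
  have mi: "1 # replicate (length Ks) 1 @ [CARD('n) - Suc (length Ks)] \<in> multi_indices (length (K # Ks @ [D])) CARD('n)"
    using len by (simp add: multi_indices_def sum_list_replicate)
  have "0 \<le> mixed_volume [K, D] [1, CARD('n) - 1]"
    by (rule mixed_volume_nonneg) (use K D in \<open>auto simp: multi_indices_def Suc_le_eq\<close>)
  then have v: "0 \<le> v" by (simp add: v_def)
  have le: "W \<le> \<mu> * w" if \<mu>: "v / vol D < \<mu>" for \<mu>
  proof -
    have \<mu>0: "0 < \<mu>" using \<mu> v pos by (meson divide_nonneg_pos le_less_trans)
    have "v < \<mu> * vol D" using \<mu> pos by (simp add: field_simps)
    then obtain x where x: "K \<subseteq> (\<lambda>y. x + \<mu> *\<^sub>R y) ` D"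
      using subset_scaled_translate[OF K D pos \<mu>0] by (auto simp: v_def)
    have "convex_body ((\<lambda>y. x + \<mu> *\<^sub>R y) ` D)"
      using D by (auto simp: convex_body_def intro!: compact_affinity convex_affinity)
    then have "W \<le> mixed_volume ((\<lambda>y. x + \<mu> *\<^sub>R y) ` D # Ks @ [D]) (1 # replicate (length Ks) 1 @ [CARD('n) - Suc (length Ks)])"
      unfolding W_def using K Ks D x mi
      by (intro mixed_volume_mono) (auto simp: list_all2_conv_all_nth nth_Cons split: nat.split)
    also have "\<dots> = \<mu> * mixed_volume (Ks @ [D]) (replicate (length Ks) 1 @ [Suc (CARD('n) - Suc (length Ks))])"
      by (rule mixed_volume_scaled_translate[OF Ks D \<mu>0]) (use len in \<open>simp_all add: sum_list_replicate\<close>)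
    also have "Suc (CARD('n) - Suc (length Ks)) = CARD('n) - length Ks" using len by simp
    finally show ?thesis by (simp add: w_def)
  qed
  have "((\<lambda>\<delta>. (v / vol D + \<delta>) * w) \<longlongrightarrow> (v / vol D + 0) * w) (at_right 0)"
    by (intro tendsto_intros)
  moreover have "\<forall>\<^sub>F \<delta> in at_right 0. W \<le> (v / vol D + \<delta>) * w"
    using le by (intro eventually_at_rightI[of 0 1]) auto
  ultimately have "W \<le> (v / vol D + 0) * w" by (rule tendsto_lowerbound) simp
  then show ?thesis
    unfolding W_def[symmetric] w_def[symmetric] v_def[symmetric] using pos by (simp add: field_simps)
qed

text \<open>Bodies are removed from the front until one is left. For a single body both sides
  coincide, so the power of \<open>n\<close> and of \<open>vol D\<close> is one less than the number
  of bodies.\<close>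

lemma mixed_volume_bezout_list:
  fixes D :: "(real ^ 'n) set"
  assumes D: "convex_body D" and pos: "0 < vol D"
    and "\<forall>K\<in>set Ks. convex_body K" "Ks \<noteq> []" "length Ks \<le> CARD('n)"
  shows "mixed_volume (Ks @ [D]) (replicate (length Ks) 1 @ [CARD('n) - length Ks]) * vol D ^ (length Ks - 1)
    \<le> real CARD('n) ^ (length Ks - 1) * prod_list (map (\<lambda>K. mixed_volume [K, D] [1, CARD('n) - 1]) Ks)"
  using assms(3-)
proof (induction Ks)
  case (Cons K Ks)
  show ?case
  proof (cases "Ks = []")
    case False
    let ?v = "mixed_volume [K, D] [1, CARD('n) - 1]"
    let ?w = "mixed_volume (Ks @ [D]) (replicate (length Ks) 1 @ [CARD('n) - length Ks])"
    let ?W = "mixed_volume (K # Ks @ [D]) (1 # replicate (length Ks) 1 @ [CARD('n) - Suc (length Ks)])"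
    obtain m where m: "length Ks = Suc m" using False by (cases Ks) auto
    have v: "0 \<le> ?v"
      by (rule mixed_volume_nonneg) (use Cons D in \<open>auto simp: multi_indices_def Suc_le_eq\<close>)
    have "?W * vol D ^ Suc m = (?W * vol D) * vol D ^ m" by simp
    also have "\<dots> \<le> (CARD('n) * ?v * ?w) * vol D ^ m"
      using mixed_volume_peel[of K Ks D] Cons.prems D pos by (intro mult_right_mono) auto
    also have "\<dots> = (CARD('n) * ?v) * (?w * vol D ^ m)" by simp
    also have "\<dots> \<le> (CARD('n) * ?v) * (real CARD('n) ^ m * prod_list (map (\<lambda>K. mixed_volume [K, D] [1, CARD('n) - 1]) Ks))"
      using Cons.IH Cons.prems False v m by (intro mult_left_mono) auto
    finally show ?thesis using m by (simp add: mult_ac)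
  qed simp
qed simp

theorem corollary1p2:
  fixes K :: "nat \<Rightarrow> (real ^ 'n) set" and D :: "(real ^ 'n) set" and r :: nat
  assumes "1 \<le> r" and "r \<le> CARD('n)"
    and "\<And>i. i \<in> {1..r} \<Longrightarrow> convex_body (K i)" and "convex_body D"
  shows "mixed_volume (map K [1..<Suc r] @ [D]) (replicate r 1 @ [CARD('n) - r]) * vol D ^ (r - 1)
       \<le> real CARD('n) ^ (r - 1) * (\<Prod>i=1..r. mixed_volume [K i, D] [1, CARD('n) - 1])"
proof -
  let ?v = "\<lambda>L. mixed_volume [L, D] [1, CARD('n) - 1]"
  have Ks: "\<forall>L\<in>set (map K [1..<Suc r]). convex_body L" using assms(3) by auto
  have prod: "prod_list (map ?v (map K [1..<Suc r])) = (\<Prod>i=1..r. ?v (K i))"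
    by (simp add: prod.distinct_set_conv_list[symmetric] comp_def atLeastLessThanSuc_atLeastAtMost del: upt_Suc)
  \<comment> \<open>For \<open>r = 1\<close> both sides agree, whatever \<open>vol D\<close> is. For
    \<open>r > 1\<close> and \<open>vol D = 0\<close> the exponent \<open>r - 1\<close> is positive,
    so the left side is zero.\<close>
  consider "r = 1" | "1 < r" "vol D = 0" | "0 < vol D"
    using assms(1) measure_nonneg[of lebesgue D] by linarith
  then show ?thesis
  proof cases
    case 1
    then show ?thesis by simp
  next
    case 2
    have "0 \<le> ?v (K i)" if "i \<in> {1..r}" for i
      by (rule mixed_volume_nonneg) (use assms(3)[OF that] assms(4) in \<open>auto simp: multi_indices_def Suc_le_eq\<close>)
    then have "0 \<le> (\<Prod>i=1..r. ?v (K i))" by (rule prod_nonneg)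
    moreover have "vol D ^ (r - 1) = 0" using 2 by simp
    ultimately show ?thesis
      by (simp only: mult_zero_right) (intro mult_nonneg_nonneg, simp_all)
  next
    case 3
    have "map K [1..<Suc r] \<noteq> []" using assms(1) by simp
    from mixed_volume_bezout_list[OF assms(4) 3 Ks this] show ?thesis
      using assms(2) unfolding prod by (simp del: upt_Suc)
  qed
qed

end
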